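(* Let $\mathcal{G}(u)=Au$ with $A\in\mathbb{R}^{K\times L}$, and let $\mu_0$ be a Gaussian probability density on $\mathbb{R}^L$. Define, for $t\ge 0$, $$\mu(t,u)=\frac{1}{Z(t)}\exp\left(-t\Phi(u;y)\right)\mu_0(u),\qquad Z(t)=\int_{\mathbb{R}^L}\exp\left(-t\Phi(u;y)\right)\mu_0(u)\,du.$$ Then $\rho(t,u)=\mu(t,u)$ is a strong solution of the Fokker-Planck equation $$\partial_t\rho=-\nabla_u\cdot\left(\left(y-\mathcal{G}(u)\right)^\top \Gamma^{-1}\mathrm{Cov}_{\mathcal{G},\rho_t}\rho\right)+\frac{1}{2}\mathrm{Tr}\left(\mathrm{Cov}_{\rho_t,\mathcal{G}}\Gamma^{-1}\mathrm{Cov}_{\mathcal{G},\rho_t}\mathcal{H}_u(\rho)\right),\qquad \rho(0,u)=\mu_0(u),$$ and $\rho(1,u)$ is the posterior density $\mu_{\mathrm{pos}}(u)=\frac1Z\exp(-\Phi(u;y))\mu_0(u)$, $Z=Z(1)$.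
   Context: Let $L,K\geq 1$, let $\Gamma\in\mathbb{R}^{K\times K}$ be symmetric positive definite, and $y\in\mathbb{R}^K$ fixed data. The loss functional is $\Phi(u;y)=\frac12\left|\Gamma^{-1/2}(y-\mathcal{G}(u))\right|^2$. For a probability density $\rho$ on $\mathbb{R}^L$ and a function $g$: $\mathbb{E}_\rho=\int u\rho(u)du$, $\mathbb{E}_{g,\rho}=\int g(u)\rho(u)du$, $\mathrm{Cov}_{\rho,g}=\int(u-\mathbb{E}_\rho)(g(u)-\mathbb{E}_{g,\rho})^\top\rho(u)du$, $\mathrm{Cov}_{g,\rho}=\mathrm{Cov}_{\rho,g}^\top$. $\rho_t$ denotes $\rho(t,\cdot)$, and $\mathcal{H}_u(\rho)$ is the Hessian of $\rho$ in $u$. *)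

theory Defs
  imports "HOL-Analysis.Analysis"
begin

section \<open>Symmetric positive definite matrices and Gaussian densities\<close>

definition sym_pos_def :: "real^'n^'n \<Rightarrow> bool" where
  "sym_pos_def M \<longleftrightarrow> transpose M = M \<and> (\<forall>x. x \<noteq> 0 \<longrightarrow> x \<bullet> (M *v x) > 0)"

text \<open>The unique symmetric positive definite square root of a symmetric positive definite
  matrix (unspecified for other matrices).\<close>

definition matrix_sqrt :: "real^'n^'n \<Rightarrow> real^'n^'n" where
  "matrix_sqrt M = (THE S. sym_pos_def S \<and> S ** S = M)"

definition gaussian_density :: "real^'n \<Rightarrow> real^'n^'n \<Rightarrow> real^'n \<Rightarrow> real" where
  "gaussian_density m C u =
     exp (- (1/2) * ((u - m) \<bullet> (matrix_inv C *v (u - m)))) / sqrt ((2 * pi) ^ CARD('n) * det C)"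

definition is_gaussian_density :: "(real^'n \<Rightarrow> real) \<Rightarrow> bool" where
  "is_gaussian_density f \<longleftrightarrow> (\<exists>m C. sym_pos_def C \<and> f = gaussian_density m C)"


section \<open>Loss functional, tempered densities and the posterior\<close>

definition loss :: "real^'k^'k \<Rightarrow> (real^'l \<Rightarrow> real^'k) \<Rightarrow> real^'k \<Rightarrow> real^'l \<Rightarrow> real" where
  "loss \<Gamma> G y u = 1/2 * (norm (matrix_inv (matrix_sqrt \<Gamma>) *v (y - G u)))\<^sup>2"

definition tempered_const :: "(real^'l \<Rightarrow> real) \<Rightarrow> (real^'l \<Rightarrow> real) \<Rightarrow> real \<Rightarrow> real" where
  "tempered_const \<Phi> \<mu>0 t = (LINT u|lborel. exp (- t * \<Phi> u) * \<mu>0 u)"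

definition tempered_density ::
    "(real^'l \<Rightarrow> real) \<Rightarrow> (real^'l \<Rightarrow> real) \<Rightarrow> real \<Rightarrow> real^'l \<Rightarrow> real" where
  "tempered_density \<Phi> \<mu>0 t u = 1 / tempered_const \<Phi> \<mu>0 t * (exp (- t * \<Phi> u) * \<mu>0 u)"

definition posterior_density :: "(real^'l \<Rightarrow> real) \<Rightarrow> (real^'l \<Rightarrow> real) \<Rightarrow> real^'l \<Rightarrow> real" where
  "posterior_density \<Phi> \<mu>0 u =
     1 / (LINT v|lborel. exp (- \<Phi> v) * \<mu>0 v) * (exp (- \<Phi> u) * \<mu>0 u)"


section \<open>Means and covariances with respect to a density\<close>

definition prob_density :: "(real^'l \<Rightarrow> real) \<Rightarrow> bool" where
  "prob_density p \<longleftrightarrow> (\<forall>u. 0 \<le> p u) \<and> integrable lborel p \<and> (LINT u|lborel. p u) = 1"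

definition outer :: "real^'l \<Rightarrow> real^'k \<Rightarrow> real^'k^'l" where
  "outer a b = (\<chi> i j. a $ i * b $ j)"

definition mean :: "(real^'l \<Rightarrow> real) \<Rightarrow> real^'l" where
  "mean p = (LINT u|lborel. p u *\<^sub>R u)"

definition mean_of :: "(real^'l \<Rightarrow> real^'k) \<Rightarrow> (real^'l \<Rightarrow> real) \<Rightarrow> real^'k" where
  "mean_of g p = (LINT u|lborel. p u *\<^sub>R g u)"

definition cov_left :: "(real^'l \<Rightarrow> real) \<Rightarrow> (real^'l \<Rightarrow> real^'k) \<Rightarrow> real^'k^'l" where
  "cov_left p g = (LINT u|lborel. p u *\<^sub>R outer (u - mean p) (g u - mean_of g p))"

definition cov_right :: "(real^'l \<Rightarrow> real^'k) \<Rightarrow> (real^'l \<Rightarrow> real) \<Rightarrow> real^'l^'k" where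
  "cov_right g p = transpose (cov_left p g)"

text \<open>Bochner integrals of non-integrable functions are 0 by convention; this predicate says that
  all the integrals above exist.\<close>

definition has_covariance :: "(real^'l \<Rightarrow> real) \<Rightarrow> (real^'l \<Rightarrow> real^'k) \<Rightarrow> bool" where
  "has_covariance p g \<longleftrightarrow>
     integrable lborel (\<lambda>u. p u *\<^sub>R u) \<and>
     integrable lborel (\<lambda>u. p u *\<^sub>R g u) \<and>
     integrable lborel (\<lambda>u. p u *\<^sub>R outer (u - mean p) (g u - mean_of g p))"


section \<open>The Fokker-Planck equation\<close>

definition divergence :: "(real^'l \<Rightarrow> real^'l) \<Rightarrow> real^'l \<Rightarrow> real" where
  "divergence F u = trace (jacobian F (at u))"

definition gradient :: "(real^'l \<Rightarrow> real) \<Rightarrow> real^'l \<Rightarrow> real^'l" where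
  "gradient f u = (\<chi> i. frechet_derivative f (at u) (axis i 1))"

definition hessian :: "(real^'l \<Rightarrow> real) \<Rightarrow> real^'l \<Rightarrow> real^'l^'l" where
  "hessian f u = jacobian (gradient f) (at u)"

definition flux ::
    "(real^'l \<Rightarrow> real^'k) \<Rightarrow> real^'k^'k \<Rightarrow> real^'k \<Rightarrow> (real^'l \<Rightarrow> real) \<Rightarrow> real^'l \<Rightarrow> real^'l" where
  "flux G \<Gamma> y p u = p u *\<^sub>R ((y - G u) v* (matrix_inv \<Gamma> ** cov_right G p))"

definition fokker_planck_rhs ::
    "(real^'l \<Rightarrow> real^'k) \<Rightarrow> real^'k^'k \<Rightarrow> real^'k \<Rightarrow> (real^'l \<Rightarrow> real) \<Rightarrow> real^'l \<Rightarrow> real" where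
  "fokker_planck_rhs G \<Gamma> y p u =
     - divergence (flux G \<Gamma> y p) u
     + 1/2 * trace (cov_left p G ** matrix_inv \<Gamma> ** cov_right G p ** hessian p u)"

text \<open>Classical regularity on \<open>[0,\<infinity>) \<times> \<real>\<^sup>L\<close>: once continuously differentiable
  in time (one-sided at time 0), twice in space, with jointly continuous derivatives.\<close>

definition classical_regularity :: "(real \<Rightarrow> real^'l \<Rightarrow> real) \<Rightarrow> bool" where
  "classical_regularity \<rho> \<longleftrightarrow>
     (\<exists>\<rho>' D H.
        (\<forall>t\<ge>0. \<forall>u.
           ((\<lambda>s. \<rho> s u) has_real_derivative \<rho>' t u) (at t within {0..}) \<and>
           GDERIV (\<rho> t) u :> D t u \<and>
           (D t has_derivative (\<lambda>h. H t u *v h)) (at u)) \<and>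
        continuous_on ({0..} \<times> UNIV) (\<lambda>(t, u). \<rho> t u) \<and>
        continuous_on ({0..} \<times> UNIV) (\<lambda>(t, u). \<rho>' t u) \<and>
        continuous_on ({0..} \<times> UNIV) (\<lambda>(t, u). D t u :: real^'l) \<and>
        continuous_on ({0..} \<times> UNIV) (\<lambda>(t, u). H t u :: real^'l^'l))"

definition strong_solution ::
    "(real^'l \<Rightarrow> real^'k) \<Rightarrow> real^'k^'k \<Rightarrow> real^'k \<Rightarrow> (real^'l \<Rightarrow> real) \<Rightarrow>
     (real \<Rightarrow> real^'l \<Rightarrow> real) \<Rightarrow> bool" where
  "strong_solution G \<Gamma> y \<mu>0 \<rho> \<longleftrightarrow>
     (\<forall>t\<ge>0. prob_density (\<rho> t) \<and> has_covariance (\<rho> t) G) \<and>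
     classical_regularity \<rho> \<and>
     (\<forall>t\<ge>0. \<forall>u. flux G \<Gamma> y (\<rho> t) differentiable (at u)) \<and>
     (\<forall>t\<ge>0. \<forall>u. ((\<lambda>s. \<rho> s u) has_real_derivative fokker_planck_rhs G \<Gamma> y (\<rho> t) u)
                   (at t within {0..})) \<and>
     (\<forall>u. \<rho> 0 u = \<mu>0 u)"

end

theory Submission
  imports Defs "HOL-Probability.Distributions"
begin

text \<open>Tempering a Gaussian by the exponential of a quadratic loss keeps it Gaussian. Completing the
  square (\<open>weight_gaussian\<close>) shows that the density \<open>\<rho> t\<close> is the Gaussian with precision
  \<open>P = C0\<^sup>-\<^sup>1 + t B\<close>, where \<open>B = A\<^sup>T \<Gamma>\<^sup>-\<^sup>1 A\<close>, mean \<open>m\<close> and covariance \<open>C = P\<^sup>-\<^sup>1\<close>. Thus the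
  covariance of state and observation is \<open>C A\<^sup>T\<close>, and every coefficient of the Fokker-Planck operator
  is explicit.

  The time derivative of \<open>\<rho>\<close> is \<open>\<rho> (E \<Phi> - \<Phi>)\<close>, where \<open>E \<Phi> = \<Phi> m + 1/2 tr (C B)\<close> is the expected
  loss (\<open>expected_loss\<close>); it arises from differentiating the normalising constant under the integral
  (\<open>tempered_const_has_derivative\<close>). In space, \<open>\<nabla> \<rho> = - \<rho> P (u - m)\<close> and
  \<open>H \<rho> = \<rho> (P (u - m) (u - m)\<^sup>T P - P)\<close>. As \<open>C P = I\<close>, all inverses cancel in drift and diffusion,
  and the equation becomes the Taylor expansion of the quadratic function \<open>\<Phi>\<close> around \<open>u\<close>
  (\<open>fokker_planck_\<rho>\<close>).

  The Gaussian integrals behind this are reduced to one dimension by the substitution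
  \<open>u = m + C\<^sup>1\<^sup>/\<^sup>2 z\<close> (\<open>gaussian_density_moments\<close>). They rest on the existence and uniqueness of square
  roots of positive definite matrices, which also give meaning to the norm in the loss, and on the
  change of variables formula for invertible matrices (\<open>nn_integral_linear\<close>) over an
  arbitrary finite index type.\<close>

section \<open>Symmetric positive definite matrices and their square roots\<close>

lemma matrix_inv_mult:
  fixes M :: "real^'n^'n"
  assumes "invertible M"
  shows "M ** matrix_inv M = mat 1" "matrix_inv M ** M = mat 1"
  using someI_ex[of "\<lambda>A'. M ** A' = mat 1 \<and> A' ** M = mat 1"] assms
  unfolding matrix_inv_def invertible_def by blast+

lemma matrix_inv_unique:
  fixes M :: "real^'n^'n"
  assumes "M ** N = mat 1"
  shows "matrix_inv M = N"
  by (metis assms invertible_right_inverse matrix_inv_mult(2) matrix_mul_assoc matrix_mul_lid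
      matrix_mul_rid)

lemma sym_pos_def_inner:
  assumes "sym_pos_def M"
  shows "x \<bullet> (M *v y) = (M *v x) \<bullet> y"
  using assms dot_lmul_matrix[of x M y] unfolding sym_pos_def_def
  by (metis matrix_transpose_mul transpose_matrix_vector vector_transpose_matrix)

lemma sym_pos_defI:
  assumes "\<And>x y. x \<bullet> (M *v y) = (M *v x) \<bullet> y" "\<And>x. x \<noteq> 0 \<Longrightarrow> x \<bullet> (M *v x) > 0"
  shows "sym_pos_def M"
proof -
  have "transpose M *v y = M *v y" for y
  proof (rule vector_eq_rdot[THEN iffD1], rule allI)
    fix x show "(transpose M *v y) \<bullet> x = (M *v y) \<bullet> x"
      using assms(1)[of y x] by (simp add: dot_lmul_matrix)
  qed
  then have "transpose M = M" by (simp add: matrix_eq)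
  with assms(2) show ?thesis by (simp add: sym_pos_def_def)
qed

lemma sym_pos_def_invertible:
  assumes "sym_pos_def M"
  shows "invertible M"
proof -
  have "x = 0" if "M *v x = 0" for x
    using assms that unfolding sym_pos_def_def by force
  then show ?thesis
    by (simp add: invertible_left_inverse matrix_left_invertible_ker)
qed

lemma sym_pos_def_inverse:
  assumes "sym_pos_def M"
  shows "sym_pos_def (matrix_inv M)"
proof (rule sym_pos_defI)
  note inv = matrix_inv_mult[OF sym_pos_def_invertible[OF assms]]
  have MN: "M *v (matrix_inv M *v x) = x" for x
    by (simp add: matrix_vector_mul_assoc inv)
  show "x \<bullet> (matrix_inv M *v y) = (matrix_inv M *v x) \<bullet> y" for x y
    by (metis MN sym_pos_def_inner[OF assms])
  show "x \<bullet> (matrix_inv M *v x) > 0" if "x \<noteq> 0" for x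
  proof -
    have "matrix_inv M *v x \<noteq> 0" using that MN[of x] by auto
    then have "(matrix_inv M *v x) \<bullet> (M *v (matrix_inv M *v x)) > 0"
      using assms by (auto simp: sym_pos_def_def)
    then show ?thesis by (simp add: MN inner_commute)
  qed
qed

text \<open>A positive continuous function on the compact unit sphere is bounded
  away from zero.\<close>

lemma sym_pos_def_coercive:
  fixes M :: "real^'n^'n"
  assumes "sym_pos_def M"
  obtains l where "l > 0" "\<And>x. l * (norm x)\<^sup>2 \<le> x \<bullet> (M *v x)"
proof -
  have ne: "sphere (0::real^'n) 1 \<noteq> {}"
    by auto
  have "continuous_on (sphere 0 1) (\<lambda>x. x \<bullet> (M *v x))"
    by (intro continuous_intros)
  then obtain x0 where x0: "x0 \<in> sphere 0 1" "\<And>x. x \<in> sphere 0 1 \<Longrightarrow> x0 \<bullet> (M *v x0) \<le> x \<bullet> (M *v x)"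
    using continuous_attains_inf[OF compact_sphere ne] by blast
  let ?l = "x0 \<bullet> (M *v x0)"
  have "x0 \<noteq> 0" using x0 by auto
  then have "?l > 0" using assms by (simp add: sym_pos_def_def)
  moreover have "?l * (norm x)\<^sup>2 \<le> x \<bullet> (M *v x)" for x
  proof (cases "x = 0")
    case False
    have "?l \<le> ((1 / norm x) *\<^sub>R x) \<bullet> (M *v ((1 / norm x) *\<^sub>R x))"
      by (rule x0(2)) (simp add: False)
    also have "\<dots> = (x \<bullet> (M *v x)) / (norm x)\<^sup>2"
      by (simp add: matrix_vector_mult_scaleR power2_eq_square)
    finally show ?thesis using False by (simp add: field_simps)
  qed simp
  ultimately show ?thesis by (rule that)
qed

text \<open>For \<open>c\<close> large enough, \<open>N = I - M / c\<close> has operator norm at most some \<open>q < 1\<close>, and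
  \<open>Y \<mapsto> (N + Y\<^sup>2) / 2\<close> is a contraction of the symmetric operators of norm at most \<open>q\<close>. Its fixed
  point satisfies \<open>(I - Y)\<^sup>2 = I - N = M / c\<close>, and \<open>I - Y\<close> is positive definite because the norm of
  \<open>Y\<close> is below one. This avoids diagonalising \<open>M\<close>.\<close>

lemma sym_pos_def_sqrt_exists:
  fixes M :: "real^'n^'n"
  assumes M: "sym_pos_def M"
  shows "\<exists>S. sym_pos_def S \<and> S ** S = M"
proof -
  obtain l where l: "l > 0" "\<And>x. l * (norm x)\<^sup>2 \<le> x \<bullet> (M *v x)"
    using sym_pos_def_coercive[OF M] by metis
  obtain K where K: "\<And>x. norm (M *v x) \<le> norm x * K"
    using bounded_linear.bounded[OF matrix_vector_mul_bounded_linear[of M]] by blast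
  define b where "b = max K l"
  have b: "b > 0" "l \<le> b" using l by (auto simp: b_def)
  have Mb: "norm (M *v x) \<le> b * norm x" for x
    using K[of x] mult_left_mono[of K b "norm x"] by (simp add: b_def mult.commute)
  \<comment> \<open>Minimises the bound \<open>1 - 2 l / c + b\<^sup>2 / c\<^sup>2\<close> for the squared norm of \<open>N\<close>.\<close>
  define c where "c = b\<^sup>2 / l"
  have c: "c > 0" using b l by (simp add: c_def)
  define N :: "(real^'n) \<Rightarrow>\<^sub>L (real^'n)" where "N = Blinfun (\<lambda>x. x - (1/c) *\<^sub>R (M *v x))"
  have N: "N x = x - (1/c) *\<^sub>R (M *v x)" for x
    unfolding N_def
    by (subst bounded_linear_Blinfun_apply)
      (auto intro!: bounded_linear_sub bounded_linear_ident bounded_linear_const_scaleR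
        matrix_vector_mul_bounded_linear)
  define q where "q = sqrt (1 - l\<^sup>2 / b\<^sup>2)"
  have lb: "l\<^sup>2 / b\<^sup>2 \<le> 1" "l\<^sup>2 / b\<^sup>2 > 0" using l b by (auto simp: power_mono)
  have q: "0 \<le> q" "q < 1" using lb by (auto simp: q_def)
  have Nq: "norm N \<le> q"
  proof (rule norm_blinfun_bound[OF q(1)])
    fix x
    have "(norm (N x))\<^sup>2 = (norm x)\<^sup>2 - 2 / c * (x \<bullet> (M *v x)) + (norm (M *v x))\<^sup>2 / c\<^sup>2"
      unfolding N power2_norm_eq_inner
      by (simp add: inner_diff_left inner_diff_right inner_commute power2_eq_square algebra_simps)
    also have "\<dots> \<le> (norm x)\<^sup>2 - 2 / c * (l * (norm x)\<^sup>2) + (b * norm x)\<^sup>2 / c\<^sup>2"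
      using l(2)[of x] Mb[of x] c
      by (intro add_mono diff_mono divide_right_mono mult_left_mono power_mono) auto
    also have "\<dots> = (1 - l\<^sup>2 / b\<^sup>2) * (norm x)\<^sup>2"
      using l b unfolding c_def by (simp add: field_simps power2_eq_square)
    also have "\<dots> = (q * norm x)\<^sup>2"
      using lb by (simp add: q_def power_mult_distrib)
    finally show "norm (N x) \<le> q * norm x"
      by (rule power2_le_imp_le) (simp add: q)
  qed
  have Nsym: "x \<bullet> N y = N x \<bullet> y" for x y
    by (simp add: N inner_diff_left inner_diff_right sym_pos_def_inner[OF M])
  define W where "W = cball 0 q \<inter> {Y :: (real^'n) \<Rightarrow>\<^sub>L (real^'n). \<forall>x y. x \<bullet> Y y = Y x \<bullet> y}"
  define F where "F Y = (1/2) *\<^sub>R (N + (Y o\<^sub>L Y))" for Y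
  have "closed W"
    unfolding W_def
    by (intro closed_Int closed_cball closed_Collect_all closed_Collect_eq continuous_intros)
  then have "complete W" by (simp add: complete_eq_closed)
  moreover have "W \<noteq> {}"
  proof -
    have "0 \<in> W" using q by (simp add: W_def)
    then show ?thesis by blast
  qed
  moreover have "F ` W \<subseteq> W"
  proof
    fix Z assume "Z \<in> F ` W"
    then obtain Y where Y: "Z = F Y" "norm Y \<le> q" "\<And>x y. x \<bullet> Y y = Y x \<bullet> y"
      by (auto simp: W_def)
    have "norm (Y o\<^sub>L Y) \<le> norm Y * norm Y" by (rule norm_blinfun_compose)
    also have "\<dots> \<le> q * 1" using Y(2) q by (intro mult_mono) auto
    finally have "norm (N + (Y o\<^sub>L Y)) \<le> q + q"
      using Nq norm_triangle_ineq[of N "Y o\<^sub>L Y"] by linarith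
    moreover have "x \<bullet> F Y y = F Y x \<bullet> y" for x y
      by (simp add: F_def blinfun.add_left blinfun.scaleR_left inner_add_left inner_add_right Nsym Y(3))
    ultimately show "Z \<in> W" by (auto simp: W_def Y F_def)
  qed
  moreover have "dist (F X) (F Y) \<le> q * dist X Y" if "X \<in> W" "Y \<in> W" for X Y
  proof -
    have eq: "F X - F Y = (1/2) *\<^sub>R ((X o\<^sub>L (X - Y)) + ((X - Y) o\<^sub>L Y))"
      by (rule blinfun_eqI) (simp add: F_def blinfun.bilinear_simps algebra_simps)
    have "norm (X o\<^sub>L (X - Y)) \<le> q * norm (X - Y)"
      using that norm_blinfun_compose[of X "X - Y"] mult_right_mono[of "norm X" q "norm (X - Y)"]
      by (simp add: W_def)
    moreover have "norm ((X - Y) o\<^sub>L Y) \<le> q * norm (X - Y)"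
      using that norm_blinfun_compose[of "X - Y" Y] mult_left_mono[of "norm Y" q "norm (X - Y)"]
      by (simp add: W_def mult.commute)
    ultimately have "norm ((X o\<^sub>L (X - Y)) + ((X - Y) o\<^sub>L Y)) \<le> 2 * (q * norm (X - Y))"
      using norm_triangle_ineq[of "X o\<^sub>L (X - Y)" "(X - Y) o\<^sub>L Y"] by linarith
    then show ?thesis unfolding dist_norm eq by simp
  qed
  ultimately obtain Y where "Y \<in> W" "F Y = Y"
    using Banach_fix[of W q F] q by blast
  then have Yq: "norm Y \<le> q" and Ys: "\<And>x y. x \<bullet> Y y = Y x \<bullet> y" and YF: "F Y = Y"
    by (auto simp: W_def)
  have YY: "2 *\<^sub>R Y x = N x + Y (Y x)" for x
    using arg_cong[OF YF, of "\<lambda>Z. 2 *\<^sub>R blinfun_apply Z x"]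
    by (simp add: F_def blinfun.bilinear_simps)
  define s where "s x = sqrt c *\<^sub>R (x - Y x)" for x
  have "linear s"
    unfolding s_def by (intro linear_compose_scale_right linear_compose_sub) (auto intro: bounded_linear.linear blinfun.bounded_linear_right simp: linear_ident)
  define S where "S = matrix s"
  have S: "S *v x = s x" for x
    by (simp add: S_def matrix_works \<open>linear s\<close>)
  have "sym_pos_def S"
  proof (rule sym_pos_defI)
    show "x \<bullet> (S *v y) = (S *v x) \<bullet> y" for x y
      by (simp add: S s_def inner_diff_left inner_diff_right Ys)
    show "x \<bullet> (S *v x) > 0" if "x \<noteq> 0" for x
    proof -
      have "x \<bullet> Y x \<le> norm x * norm (Y x)" by (rule norm_cauchy_schwarz)
      also have "\<dots> \<le> norm x * (q * norm x)"
        using norm_blinfun[of Y x] Yq mult_right_mono[of "norm Y" q "norm x"]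
        by (intro mult_left_mono) simp_all
      also have "\<dots> < norm x * norm x" using q that by simp
      also have "\<dots> = x \<bullet> x" by (simp add: power2_norm_eq_inner flip: power2_eq_square)
      finally show ?thesis using c by (simp add: S s_def inner_diff_right)
    qed
  qed
  moreover have "S ** S = M"
  proof (rule matrix_eq[THEN iffD2], rule allI)
    fix x
    have "(S ** S) *v x = s (s x)" by (simp add: S flip: matrix_vector_mul_assoc)
    also have "\<dots> = c *\<^sub>R (x - 2 *\<^sub>R Y x + Y (Y x))"
      using c by (simp add: s_def blinfun.bilinear_simps algebra_simps scaleR_2)
    also have "\<dots> = M *v x" using c unfolding YY N by simp
    finally show "(S ** S) *v x = M *v x" .
  qed
  ultimately show ?thesis by blast
qed

lemma sym_pos_def_nonneg: "sym_pos_def M \<Longrightarrow> x \<bullet> (M *v x) \<ge> 0"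
  by (cases "x = 0") (auto simp: sym_pos_def_def intro: less_imp_le)

lemma trace_inner: "trace M = (\<Sum>i\<in>UNIV. axis i 1 \<bullet> (M *v axis i 1))" for M :: "real^'n^'n"
  by (simp add: trace_def inner_axis' matrix_vector_mult_basis column_def)

text \<open>For \<open>X = S - T\<close>, equality of the squares gives \<open>S X + X T = 0\<close>. Multiplying by \<open>X\<close> and taking
  traces yields \<open>tr (X S X) + tr (X T X) = 0\<close>, a sum of nonnegative terms that vanishes only
  if every column of \<open>X\<close> does.\<close>

lemma sym_pos_def_sqrt_unique:
  fixes S T :: "real^'n^'n"
  assumes S: "sym_pos_def S" and T: "sym_pos_def T" and eq: "S ** S = T ** T"
  shows "S = T"
proof -
  define X where "X = S - T"
  define d where "d i = X *v axis i (1::real)" for i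
  have Xsym: "x \<bullet> (X *v y) = (X *v x) \<bullet> y" for x y
    by (simp add: X_def matrix_vector_mult_diff_rdistrib inner_diff_left inner_diff_right
        sym_pos_def_inner[OF S] sym_pos_def_inner[OF T])
  have "S *v (S *v x) = T *v (T *v x)" for x
    using eq by (simp add: matrix_vector_mul_assoc)
  then have "(S ** X + X ** T) *v x = 0" for x
    unfolding matrix_vector_mult_add_rdistrib matrix_vector_mul_assoc[symmetric] X_def
      matrix_vector_mult_diff_rdistrib matrix_vector_mult_diff_distrib by simp
  then have "S ** X + X ** T = 0" by (simp add: matrix_eq)
  then have "trace (X ** (S ** X + X ** T)) = 0" by (simp add: trace_def)
  then have "trace (X ** (S ** X)) + trace (X ** (X ** T)) = 0"
    by (simp add: matrix_add_ldistrib trace_add)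
  moreover have "trace (X ** (X ** T)) = trace (X ** (T ** X))"
    by (metis matrix_mul_assoc trace_mul_sym)
  moreover have "trace (X ** (R ** X)) = (\<Sum>i\<in>UNIV. d i \<bullet> (R *v d i))" for R
    unfolding trace_inner d_def by (simp add: Xsym flip: matrix_vector_mul_assoc)
  ultimately have "(\<Sum>i\<in>UNIV. d i \<bullet> (S *v d i)) + (\<Sum>i\<in>UNIV. d i \<bullet> (T *v d i)) = 0"
    by simp
  moreover have "(\<Sum>i\<in>UNIV. d i \<bullet> (S *v d i)) \<ge> 0" "(\<Sum>i\<in>UNIV. d i \<bullet> (T *v d i)) \<ge> 0"
    by (intro sum_nonneg sym_pos_def_nonneg S T)+
  ultimately have "(\<Sum>i\<in>UNIV. d i \<bullet> (S *v d i)) = 0" by linarith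
  then have "d i \<bullet> (S *v d i) = 0" for i
    by (subst (asm) sum_nonneg_eq_0_iff) (auto intro: sym_pos_def_nonneg S)
  then have "d i = 0" for i
    using S unfolding sym_pos_def_def by (metis less_irrefl)
  then have "column i X = 0" for i by (simp add: d_def matrix_vector_mult_basis)
  then have "X = 0" by (simp add: column_def vec_eq_iff)
  then show ?thesis by (simp add: X_def)
qed

lemma matrix_sqrt_props:
  assumes "sym_pos_def M"
  shows "sym_pos_def (matrix_sqrt M)" "matrix_sqrt M ** matrix_sqrt M = M"
proof -
  have "\<exists>!S. sym_pos_def S \<and> S ** S = M"
    using sym_pos_def_sqrt_exists[OF assms] sym_pos_def_sqrt_unique by metis
  from theI'[OF this] show "sym_pos_def (matrix_sqrt M)" "matrix_sqrt M ** matrix_sqrt M = M"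
    by (simp_all add: matrix_sqrt_def)
qed

text \<open>The square root enters the loss only through its square, so that all later computations need
  just the inverse of \<open>\<Gamma>\<close>.\<close>

lemma loss_eq:
  assumes "sym_pos_def \<Gamma>"
  shows "loss \<Gamma> G y u = 1/2 * ((y - G u) \<bullet> (matrix_inv \<Gamma> *v (y - G u)))"
proof -
  let ?S = "matrix_sqrt \<Gamma>"
  let ?R = "matrix_inv ?S"
  note S = matrix_sqrt_props[OF assms]
  note R = matrix_inv_mult[OF sym_pos_def_invertible[OF S(1)]]
  have "\<Gamma> ** (?R ** ?R) = mat 1"
    by (metis S(2) R(1) matrix_mul_assoc matrix_mul_rid)
  then have "matrix_inv \<Gamma> = ?R ** ?R" by (rule matrix_inv_unique)
  then show ?thesis
    by (simp add: loss_def power2_norm_eq_inner sym_pos_def_inner[OF sym_pos_def_inverse[OF S(1)]]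
        flip: matrix_vector_mul_assoc)
qed

section \<open>Linear changes of variables for Lebesgue measure\<close>

text \<open>The change of variables by an invertible matrix is derived from translation invariance alone.
  Uniqueness of Haar measure, in the form of \<open>nn_integral_linear_exchange\<close>, shows that the pullback by an
  invertible matrix multiplies integrals by a constant depending multiplicatively on the matrix. It
  then suffices to find this constant for elementary matrices.\<close>

lemma nn_integral_lborel_shift:
  fixes f :: "'a::euclidean_space \<Rightarrow> ennreal"
  assumes [measurable]: "f \<in> borel_measurable borel"
  shows "(\<integral>\<^sup>+x. f (a + x) \<partial>lborel) = (\<integral>\<^sup>+x. f x \<partial>lborel)"
proof -
  have "(\<integral>\<^sup>+x. f x \<partial>distr lborel borel ((+) a)) = (\<integral>\<^sup>+x. f (a + x) \<partial>lborel)"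
    by (subst nn_integral_distr) auto
  then show ?thesis by (simp add: lborel_distr_plus)
qed

lemma measurable_matrix_vector_mult [measurable]:
  fixes S :: "real^'n^'m"
  shows "(*v) S \<in> borel_measurable borel"
  by (intro borel_measurable_continuous_onI continuous_intros)

text \<open>Write the left-hand side as the double integral of \<open>f (S x) * g (S x + y)\<close>. Translating \<open>x\<close>
  turns it into that of \<open>f (S x - y) * g (S x)\<close>, and evenness of \<open>f\<close> makes this a translation
  of \<open>f\<close> in \<open>y\<close>.\<close>

lemma nn_integral_linear_exchange:
  fixes S :: "real^'n^'n" and f g :: "real^'n \<Rightarrow> ennreal"
  assumes S: "invertible S"
    and [measurable]: "f \<in> borel_measurable borel" "g \<in> borel_measurable borel"
    and even: "\<And>x. f (- x) = f x"
  shows "(\<integral>\<^sup>+x. f (S *v x) \<partial>lborel) * (\<integral>\<^sup>+x. g x \<partial>lborel) =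
         (\<integral>\<^sup>+x. g (S *v x) \<partial>lborel) * (\<integral>\<^sup>+x. f x \<partial>lborel)"
proof -
  obtain R where R: "S ** R = mat 1" using S by (auto simp: invertible_def)
  have SR: "S *v (R *v y) = y" for y by (simp add: matrix_vector_mul_assoc R)
  have [measurable]: "(\<lambda>x. f (S *v x)) \<in> borel_measurable borel" "(\<lambda>x. g (S *v x)) \<in> borel_measurable borel"
    by measurable
  have "(\<integral>\<^sup>+x. f (S *v x) \<partial>lborel) * (\<integral>\<^sup>+x. g x \<partial>lborel) =
        (\<integral>\<^sup>+x. f (S *v x) * (\<integral>\<^sup>+y. g (S *v x + y) \<partial>lborel) \<partial>lborel)"
    by (simp add: nn_integral_multc nn_integral_lborel_shift)
  also have "\<dots> = (\<integral>\<^sup>+x. (\<integral>\<^sup>+y. f (S *v x) * g (S *v x + y) \<partial>lborel) \<partial>lborel)"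
    by (intro nn_integral_cong nn_integral_cmult[symmetric]) measurable
  also have "\<dots> = (\<integral>\<^sup>+y. (\<integral>\<^sup>+x. f (S *v x) * g (S *v x + y) \<partial>lborel) \<partial>lborel)"
    by (rule lborel_pair.Fubini') measurable
  also have "\<dots> = (\<integral>\<^sup>+y. (\<integral>\<^sup>+x. f (S *v x - y) * g (S *v x) \<partial>lborel) \<partial>lborel)"
  proof (rule nn_integral_cong)
    fix y
    have "(\<integral>\<^sup>+x. f (S *v x - y) * g (S *v x) \<partial>lborel) =
          (\<integral>\<^sup>+x. f (S *v (R *v y + x) - y) * g (S *v (R *v y + x)) \<partial>lborel)"
      by (rule nn_integral_lborel_shift[symmetric]) measurable
    then show "(\<integral>\<^sup>+x. f (S *v x) * g (S *v x + y) \<partial>lborel) =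
               (\<integral>\<^sup>+x. f (S *v x - y) * g (S *v x) \<partial>lborel)"
      by (simp add: matrix_vector_right_distrib SR add.commute)
  qed
  also have "\<dots> = (\<integral>\<^sup>+x. (\<integral>\<^sup>+y. f (S *v x - y) * g (S *v x) \<partial>lborel) \<partial>lborel)"
    by (rule lborel_pair.Fubini') measurable
  also have "\<dots> = (\<integral>\<^sup>+x. (\<integral>\<^sup>+y. f (- (S *v x) + y) \<partial>lborel) * g (S *v x) \<partial>lborel)"
  proof (rule nn_integral_cong)
    fix x
    have "f (S *v x - y) = f (- (S *v x) + y)" for y
      using even[of "S *v x - y"] by simp
    then show "(\<integral>\<^sup>+y. f (S *v x - y) * g (S *v x) \<partial>lborel) =
               (\<integral>\<^sup>+y. f (- (S *v x) + y) \<partial>lborel) * g (S *v x)"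
      by (simp add: nn_integral_multc)
  qed
  also have "\<dots> = (\<integral>\<^sup>+x. f x \<partial>lborel) * (\<integral>\<^sup>+x. g (S *v x) \<partial>lborel)"
    unfolding nn_integral_lborel_shift[OF assms(2)] by (rule nn_integral_cmult) measurable
  finally show ?thesis by (simp add: mult.commute)
qed

lemma emeasure_unit_ball:
  "emeasure lborel (ball (0::'a::euclidean_space) 1) \<noteq> 0"
  "emeasure lborel (ball (0::'a::euclidean_space) 1) \<noteq> \<infinity>"
proof -
  show "emeasure lborel (ball (0::'a) 1) \<noteq> 0"
  proof
    assume "emeasure lborel (ball (0::'a) 1) = 0"
    then have "ball (0::'a) 1 \<in> null_sets lborel" by (auto simp: null_sets_def)
    then have "ball (0::'a) 1 \<in> null_sets lebesgue" by (rule null_sets_completionI)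
    then have "negligible (ball (0::'a) 1)" by (simp add: negligible_iff_null_sets)
    then show False using negligible_imp_measure0 content_ball_pos[of 1 "0::'a"] by force
  qed
  show "emeasure lborel (ball (0::'a) 1) \<noteq> \<infinity>"
    using emeasure_bounded_finite[OF bounded_ball, of "0::'a" 1] by (simp add: less_top)
qed

lemma borel_measurable_indicator_ball [measurable]:
  "indicator (ball a r) \<in> borel_measurable borel"
  by (rule borel_measurable_indicator) simp

lemma nn_integral_linear_isometry:
  fixes S :: "real^'n^'n" and g :: "real^'n \<Rightarrow> ennreal"
  assumes "invertible S" "\<And>x. norm (S *v x) = norm x" and [measurable]: "g \<in> borel_measurable borel"
  shows "(\<integral>\<^sup>+x. g (S *v x) \<partial>lborel) = (\<integral>\<^sup>+x. g x \<partial>lborel)"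
proof -
  let ?f = "indicator (ball 0 1) :: real^'n \<Rightarrow> ennreal"
  let ?b = "emeasure lborel (ball (0::real^'n) 1)"
  have f: "?f (S *v x) = ?f x" "?f (- x) = ?f x" for x by (simp_all add: indicator_def assms(2))
  have "?b * (\<integral>\<^sup>+x. g x \<partial>lborel) = (\<integral>\<^sup>+x. g (S *v x) \<partial>lborel) * ?b"
    using nn_integral_linear_exchange[OF assms(1), of ?f g] borel_measurable_indicator_ball by (simp add: f)
  then have "?b * (\<integral>\<^sup>+x. g x \<partial>lborel) = ?b * (\<integral>\<^sup>+x. g (S *v x) \<partial>lborel)"
    by (simp add: mult.commute)
  then show ?thesis
    using emeasure_unit_ball[where 'a = "real^'n"] by (subst (asm) ennreal_mult_cancel_left) auto
qed

lemma nn_integral_linear_const: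
  fixes S :: "real^'n^'n"
  assumes S: "invertible S"
  obtains c :: ennreal where "c \<noteq> 0" "c \<noteq> \<infinity>"
    "\<And>g :: real^'n \<Rightarrow> ennreal. g \<in> borel_measurable borel \<Longrightarrow>
        (\<integral>\<^sup>+x. g (S *v x) \<partial>lborel) = c * (\<integral>\<^sup>+x. g x \<partial>lborel)"
proof -
  let ?f = "indicator (ball 0 1) :: real^'n \<Rightarrow> ennreal"
  let ?b = "emeasure lborel (ball (0::real^'n) 1)"
  note b = emeasure_unit_ball[where 'a = "real^'n"]
  define c where "c S = (\<integral>\<^sup>+x. ?f (S *v x) \<partial>lborel) / ?b" for S :: "real^'n^'n"
  have even: "?f (- x) = ?f x" for x by (simp add: indicator_def)
  have c: "(\<integral>\<^sup>+x. g (S *v x) \<partial>lborel) = c S * (\<integral>\<^sup>+x. g x \<partial>lborel)"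
    if "invertible S" and [measurable]: "g \<in> borel_measurable borel"
    for g :: "real^'n \<Rightarrow> ennreal" and S :: "real^'n^'n"
  proof -
    have "(\<integral>\<^sup>+x. ?f (S *v x) \<partial>lborel) * (\<integral>\<^sup>+x. g x \<partial>lborel) = (\<integral>\<^sup>+x. g (S *v x) \<partial>lborel) * ?b"
      using nn_integral_linear_exchange[OF that(1), of ?f g] borel_measurable_indicator_ball by (simp add: even)
    then have "(\<integral>\<^sup>+x. g (S *v x) \<partial>lborel) * ?b / ?b = c S * (\<integral>\<^sup>+x. g x \<partial>lborel)"
      by (simp add: c_def ennreal_times_divide mult.commute)
    then show ?thesis using b by (simp add: ennreal_mult_divide_eq)
  qed
  obtain R where R: "S ** R = mat 1" "R ** S = mat 1" using S by (auto simp: invertible_def)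
  then have "invertible R" by (auto simp: invertible_def)
  have "?b = (\<integral>\<^sup>+x. ?f (S *v (R *v x)) \<partial>lborel)"
    by (simp add: matrix_vector_mul_assoc R)
  also have "\<dots> = c R * (c S * ?b)"
    using c[OF \<open>invertible R\<close>, of "\<lambda>x. ?f (S *v x)"] c[OF S, of ?f] by simp
  finally have "c R * c S * ?b / ?b = ?b / ?b" by (simp add: mult.assoc)
  then have "c R * c S = 1" using b by (simp add: ennreal_mult_divide_eq ennreal_divide_self less_top)
  then have "c S \<noteq> 0" "c S \<noteq> \<infinity>"
    by (auto simp: ennreal_mult_top split: if_splits)
  then show ?thesis using that c[OF S] by blast
qed

lemma diagonal_matrix_vector_mult:
  fixes A :: "real^'n^'n"
  assumes A: "\<And>i j. i \<noteq> j \<Longrightarrow> A $ i $ j = 0"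
  shows "(A *v x) $ i = A $ i $ i * x $ i"
proof -
  have "(A *v x) $ i = (\<Sum>j\<in>UNIV. if j = i then A $ i $ i * x $ i else 0)"
    unfolding matrix_vector_mult_def vec_lambda_beta
  proof (rule sum.cong[OF refl])
    fix j show "A $ i $ j * x $ j = (if j = i then A $ i $ i * x $ i else 0)"
      using A[of i j] by (cases "j = i") auto
  qed
  then show ?thesis by simp
qed

text \<open>If the diagonal matrix \<open>D\<close> doubles the coordinate \<open>m\<close>, then \<open>D E = E E D\<close>: conjugation doubles
  the shear coefficient. Every quantity that is multiplicative and nonzero, such as the determinant
  and the constant of the change of variables, therefore takes the value one at a shear.\<close>

lemma nn_integral_shear:
  fixes m n :: "'n::finite" and a :: real and g :: "real^'n \<Rightarrow> ennreal"
  defines "E \<equiv> (\<chi> i j. if i = m \<and> j = n then a else of_bool (i = j)) :: real^'n^'n"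
  assumes mn: "m \<noteq> n" and g: "g \<in> borel_measurable borel"
  shows "det E = 1" "(\<integral>\<^sup>+x. g (E *v x) \<partial>lborel) = (\<integral>\<^sup>+x. g x \<partial>lborel)"
proof -
  define D :: "real^'n^'n" where "D = (\<chi> i j. if i = j then (if i = m then 2 else 1) else 0)"
  have E: "(\<chi> i j. if i = m \<and> j = n then b else of_bool (i = j)) *v x = x + (b * x $ n) *\<^sub>R axis m 1"
    for b and x :: "real^'n"
  proof -
    have "(\<Sum>j\<in>UNIV. (if i = m \<and> j = n then b else of_bool (i = j)) * x $ j) =
      x $ i + b * x $ n * (axis m 1 :: real^'n) $ i" for i
    proof -
      have "(\<Sum>j\<in>UNIV. (if i = m \<and> j = n then b else of_bool (i = j)) * x $ j) =
        (\<Sum>j\<in>UNIV. (if j = i then x $ j else 0) + (if j = n then (if i = m then b * x $ n else 0) else 0))"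
        using mn by (intro sum.cong) auto
      then show ?thesis by (auto simp: sum.distrib axis_def)
    qed
    then show ?thesis by (simp add: vec_eq_iff matrix_vector_mult_def)
  qed
  have D: "(D *v x) $ i = (if i = m then 2 else 1) * x $ i" for x i
    by (subst diagonal_matrix_vector_mult) (simp_all add: D_def)
  have detD: "det D = (\<Prod>i\<in>UNIV. if i = m then 2 else 1)"
    unfolding D_def by (subst det_diagonal) auto
  have "det D \<noteq> 0" unfolding detD by (auto simp: prod_zero_iff)
  then have iD: "invertible D" by (simp add: invertible_det_nz)
  have iE: "invertible E"
    unfolding invertible_right_inverse
    by (rule exI[of _ "\<chi> i j. if i = m \<and> j = n then - a else of_bool (i = j)"])
      (use mn in \<open>simp add: matrix_eq E_def E axis_def flip: matrix_vector_mul_assoc\<close>)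
  have EE: "D ** E = E ** (E ** D)"
    unfolding matrix_eq matrix_vector_mul_assoc[symmetric] vec_eq_iff D
    using mn by (auto simp: E_def E D axis_def)
  have "det D * det E = det E * (det E * det D)"
    using arg_cong[OF EE, of det] by (simp add: det_mul)
  then show "det E = 1"
    using iE \<open>det D \<noteq> 0\<close> by (simp add: invertible_det_nz)
  obtain d where d: "d \<noteq> 0" "d \<noteq> \<infinity>" "\<And>g :: real^'n \<Rightarrow> ennreal. g \<in> borel_measurable borel \<Longrightarrow>
        (\<integral>\<^sup>+x. g (D *v x) \<partial>lborel) = d * (\<integral>\<^sup>+x. g x \<partial>lborel)"
    using nn_integral_linear_const[OF iD] by metis
  obtain e where e: "e \<noteq> 0" "e \<noteq> \<infinity>" "\<And>g :: real^'n \<Rightarrow> ennreal. g \<in> borel_measurable borel \<Longrightarrow>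
        (\<integral>\<^sup>+x. g (E *v x) \<partial>lborel) = e * (\<integral>\<^sup>+x. g x \<partial>lborel)"
    using nn_integral_linear_const[OF iE] by metis
  let ?f = "indicator (ball 0 1) :: real^'n \<Rightarrow> ennreal"
  let ?b = "emeasure lborel (ball (0::real^'n) 1)"
  note b = emeasure_unit_ball[where 'a = "real^'n"]
  have "(\<integral>\<^sup>+x. ?f ((D ** E) *v x) \<partial>lborel) = e * (d * ?b)"
    using e(3)[of "\<lambda>x. ?f (D *v x)"] d(3)[of ?f] by (simp flip: matrix_vector_mul_assoc)
  moreover have "(\<integral>\<^sup>+x. ?f ((E ** (E ** D)) *v x) \<partial>lborel) = d * (e * (e * ?b))"
    using d(3)[of "\<lambda>x. ?f (E *v (E *v x))"] e(3)[of "\<lambda>x. ?f (E *v x)"] e(3)[of ?f]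
    by (simp flip: matrix_vector_mul_assoc)
  ultimately have "(e * d * ?b) * 1 = (e * d * ?b) * e"
    unfolding EE by (simp add: ac_simps)
  then have "e = 1"
    using d e b by (subst (asm) ennreal_mult_cancel_left) (auto simp: ennreal_mult_eq_top_iff)
  then show "(\<integral>\<^sup>+x. g (E *v x) \<partial>lborel) = (\<integral>\<^sup>+x. g x \<partial>lborel)"
    using e(3)[OF g] by simp
qed

lemma nn_integral_linear:
  fixes S :: "real^'n^'n" and g :: "real^'n \<Rightarrow> ennreal"
  assumes "det S \<noteq> 0" "g \<in> borel_measurable borel"
  shows "ennreal \<bar>det S\<bar> * (\<integral>\<^sup>+x. g (S *v x) \<partial>lborel) = (\<integral>\<^sup>+x. g x \<partial>lborel)"
proof -
  define P :: "real^'n^'n \<Rightarrow> bool" where "P S \<longleftrightarrow> (det S \<noteq> 0 \<longrightarrow> (\<forall>g::real^'n \<Rightarrow> ennreal. g \<in> borel_measurable borel \<longrightarrow>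
     ennreal \<bar>det S\<bar> * (\<integral>\<^sup>+x. g (S *v x) \<partial>lborel) = (\<integral>\<^sup>+x. g x \<partial>lborel)))" for S
  have "P S"
  proof (rule induct_matrix_elementary[of P])
    fix A B assume AB: "P A" "P B"
    show "P (A ** B)"
      unfolding P_def
    proof (intro impI allI)
      fix g :: "real^'n \<Rightarrow> ennreal"
      assume "det (A ** B) \<noteq> 0" and [measurable]: "g \<in> borel_measurable borel"
      then have d: "det A \<noteq> 0" "det B \<noteq> 0" by (auto simp: det_mul)
      have "ennreal \<bar>det (A ** B)\<bar> * (\<integral>\<^sup>+x. g ((A ** B) *v x) \<partial>lborel) =
        ennreal \<bar>det A\<bar> * (ennreal \<bar>det B\<bar> * (\<integral>\<^sup>+x. g (A *v (B *v x)) \<partial>lborel))"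
        by (simp add: det_mul abs_mult ennreal_mult mult.assoc flip: matrix_vector_mul_assoc)
      also have "ennreal \<bar>det B\<bar> * (\<integral>\<^sup>+x. g (A *v (B *v x)) \<partial>lborel) = (\<integral>\<^sup>+x. g (A *v x) \<partial>lborel)"
        using AB(2) d unfolding P_def by (auto dest!: spec[of _ "\<lambda>x. g (A *v x)"])
      also have "ennreal \<bar>det A\<bar> * \<dots> = (\<integral>\<^sup>+x. g x \<partial>lborel)"
        using AB(1) d unfolding P_def by auto
      finally show "ennreal \<bar>det (A ** B)\<bar> * (\<integral>\<^sup>+x. g ((A ** B) *v x) \<partial>lborel) = (\<integral>\<^sup>+x. g x \<partial>lborel)" .
    qed
  next
    fix A :: "real^'n^'n" and i assume "row i A = 0"
    then show "P A" by (simp add: P_def det_zero_row)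
  next
    fix A :: "real^'n^'n" assume A: "\<And>i j. i \<noteq> j \<Longrightarrow> A $ i $ j = 0"
    show "P A"
      unfolding P_def
    proof (intro impI allI)
      fix g :: "real^'n \<Rightarrow> ennreal"
      assume nz: "det A \<noteq> 0" and [measurable]: "g \<in> borel_measurable borel"
      have det: "det A = (\<Prod>i\<in>UNIV. A $ i $ i)" by (rule det_diagonal) (rule A)
      define c :: "real^'n \<Rightarrow> real" where "c v = v \<bullet> (A *v v)" for v
      have c: "c (axis i 1) = A $ i $ i" for i
        by (simp add: c_def inner_axis' matrix_vector_mult_basis column_def)
      have nzi: "A $ i $ i \<noteq> 0" for i using nz by (simp add: det)
      have T: "0 + (\<Sum>j\<in>Basis. (c j * (x \<bullet> j)) *\<^sub>R j) = A *v x" for x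
      proof -
        have "(A *v x) $ i = A $ i $ i * x $ i" for i
          using A by (rule diagonal_matrix_vector_mult)
        moreover have "(\<Sum>j\<in>Basis. (c j * (x \<bullet> j)) *\<^sub>R j) $ i = A $ i $ i * x $ i" for i
        proof -
          have "(\<Sum>j\<in>Basis. (c j * (x \<bullet> j)) *\<^sub>R j) $ i = (\<Sum>j\<in>UNIV. (c (axis j 1) * x $ j) * (axis j 1 :: real^'n) $ i)"
            by (simp add: Basis_vec_def UNION_singleton_eq_range sum.reindex inj_on_def axis_eq_axis inner_axis)
          also have "\<dots> = (\<Sum>j\<in>UNIV. if j = i then A $ i $ i * x $ i else 0)"
          proof (rule sum.cong[OF refl])
            fix j
            have "(axis j 1 :: real^'n) $ i = (if j = i then 1 else 0)" by (simp add: axis_def)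
            then show "(c (axis j 1) * x $ j) * (axis j 1 :: real^'n) $ i =
                (if j = i then A $ i $ i * x $ i else 0)"
              by (simp add: c)
          qed
          finally show ?thesis by simp
        qed
        ultimately show ?thesis by (simp add: vec_eq_iff)
      qed
      have dc: "(\<Prod>j\<in>Basis. \<bar>c j\<bar>) = \<bar>det A\<bar>"
        by (simp add: det abs_prod Basis_vec_def UNION_singleton_eq_range prod.reindex inj_on_def axis_eq_axis c)
      have "c j \<noteq> 0" if "j \<in> Basis" for j
        using that nzi by (auto simp: Basis_vec_def c)
      from lborel_affine_euclidean[of c 0, OF this]
      have "lborel = density (distr lborel borel ((*v) A)) (\<lambda>_. ennreal \<bar>det A\<bar>)"
        unfolding T dc by simp
      then have "(\<integral>\<^sup>+x. g x \<partial>lborel) = (\<integral>\<^sup>+x. g x \<partial>density (distr lborel borel ((*v) A)) (\<lambda>_. ennreal \<bar>det A\<bar>))"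
        by simp
      also have "\<dots> = ennreal \<bar>det A\<bar> * (\<integral>\<^sup>+x. g (A *v x) \<partial>lborel)"
        by (simp add: nn_integral_density nn_integral_distr nn_integral_cmult)
      finally show "ennreal \<bar>det A\<bar> * (\<integral>\<^sup>+x. g (A *v x) \<partial>lborel) = (\<integral>\<^sup>+x. g x \<partial>lborel)" ..
    qed
  next
    fix m n :: 'n assume "m \<noteq> n"
    define A :: "real^'n^'n" where "A = (\<chi> i j. mat 1 $ i $ Transposition.transpose m n j)"
    have A: "A *v x = (\<chi> i. x $ Transposition.transpose m n i)" for x
    proof -
      have "(A *v x) $ i = (\<Sum>j\<in>UNIV. if j = Transposition.transpose m n i then x $ j else 0)" for i
        unfolding matrix_vector_mult_def A_def mat_def vec_lambda_beta
        by (rule sum.cong[OF refl]) (auto simp: Transposition.transpose_def)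
      then show ?thesis by (simp add: vec_eq_iff)
    qed
    have iso: "norm (A *v x) = norm x" for x
      unfolding norm_eq_sqrt_inner A inner_vec_def
      using sum.permute[OF permutes_swap_id[of m UNIV n], of "\<lambda>i. x $ i * x $ i"]
      by (simp add: o_def)
    then have orth: "orthogonal_transformation ((*v) A)"
      by (simp add: orthogonal_transformation)
    then have "orthogonal_matrix A"
      by (simp add: orthogonal_transformation_matrix)
    then have "\<bar>det A\<bar> = 1" using det_orthogonal_matrix by force
    moreover from this have "invertible A" by (auto simp: invertible_det_nz)
    ultimately have "P A"
      by (simp add: P_def nn_integral_linear_isometry iso)
    then show "P (\<chi> i j. mat 1 $ i $ Transposition.transpose m n j)" by (simp add: A_def)
  next
    fix m n :: 'n and c :: real assume "m \<noteq> n"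
    then show "P (\<chi> i j. if i = m \<and> j = n then c else of_bool (i = j))"
      by (simp add: P_def nn_integral_shear)
  qed
  with assms show ?thesis by (simp add: P_def)
qed

text \<open>Only the linear part changes volume; the measure form of the statement transfers Bochner
  integrals as well.\<close>

lemma lborel_affine_matrix:
  fixes S :: "real^'n^'n"
  assumes "det S \<noteq> 0"
  shows "lborel = density (distr lborel borel (\<lambda>x. m + S *v x)) (\<lambda>_. ennreal \<bar>det S\<bar>)"
proof (rule measure_eqI)
  fix A :: "(real^'n) set" assume "A \<in> sets lborel"
  then have [measurable]: "A \<in> sets borel" by simp
  let ?D = "density (distr lborel borel (\<lambda>x. m + S *v x)) (\<lambda>_. ennreal \<bar>det S\<bar>)"
  have "emeasure ?D A = ennreal \<bar>det S\<bar> * (\<integral>\<^sup>+x. indicator A (m + S *v x) \<partial>lborel)"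
    by (subst emeasure_density, simp, simp, subst nn_integral_distr, simp, simp, rule nn_integral_cmult) simp
  also have "\<dots> = (\<integral>\<^sup>+x. indicator A (m + x) \<partial>lborel)"
    by (rule nn_integral_linear[OF assms]) measurable
  also have "\<dots> = emeasure lborel A"
    by (subst nn_integral_lborel_shift) simp_all
  finally show "emeasure lborel A = emeasure ?D A" ..
qed simp

lemma has_bochner_integral_affine_matrix:
  fixes S :: "real^'n^'n" and f :: "real^'n \<Rightarrow> real"
  assumes "det S \<noteq> 0" and [measurable]: "f \<in> borel_measurable borel"
    and "has_bochner_integral lborel (\<lambda>z. \<bar>det S\<bar> * f (m + S *v z)) I"
  shows "has_bochner_integral lborel f I"
proof -
  have "has_bochner_integral (density (distr lborel borel (\<lambda>x. m + S *v x)) (\<lambda>_. ennreal \<bar>det S\<bar>)) f I"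
    by (rule has_bochner_integral_density) (use assms(3) in \<open>auto simp: has_bochner_integral_distr\<close>)
  then show ?thesis by (simp only: lborel_affine_matrix[OF assms(1), symmetric])
qed

section \<open>Moments of Gaussian densities\<close>

lemma has_bochner_integral_lborel_vec_prod:
  fixes f :: "'n::finite \<Rightarrow> real \<Rightarrow> real"
  assumes f: "\<And>i. has_bochner_integral lborel (f i) (I i)"
  shows "has_bochner_integral lborel (\<lambda>z::real^'n. \<Prod>i\<in>UNIV. f i (z $ i)) (\<Prod>i\<in>UNIV. I i)"
proof -
  interpret product_sigma_finite "\<lambda>_::real^'n. lborel :: real measure" ..
  define e :: "'n \<Rightarrow> real^'n" where "e i = axis i 1" for i
  have e: "bij_betw e UNIV Basis"
    by (auto simp: e_def bij_betw_def inj_on_def axis_eq_axis Basis_vec_def)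
  then have inj: "inj e" by (simp add: bij_betw_def)
  have [measurable]: "f i \<in> borel_measurable borel" for i
    using borel_measurable_has_bochner_integral[OF f[of i]] by simp
  have "(\<Prod>i\<in>UNIV. f i ((\<Sum>b\<in>Basis. x b *\<^sub>R b) $ i)) = (\<Prod>b\<in>Basis. f (inv e b) (x b))" for x
  proof -
    have "(\<Sum>b\<in>Basis. x b *\<^sub>R b) $ i = x (e i)" for i
    proof -
      have "e i \<in> Basis" using e by (auto simp: bij_betw_def)
      then have "(\<Sum>b\<in>Basis. x b *\<^sub>R b) \<bullet> e i = x (e i)" by (rule inner_sum_left_Basis)
      then show ?thesis by (simp add: e_def inner_axis)
    qed
    then show ?thesis
      by (simp add: prod.reindex_bij_betw[OF e, symmetric] inj)
  qed
  moreover have "(\<Prod>i\<in>UNIV. I i) = (\<Prod>b\<in>Basis. I (inv e b))"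
    by (simp add: prod.reindex_bij_betw[OF e, symmetric] inj)
  moreover have "has_bochner_integral (\<Pi>\<^sub>M b\<in>Basis. lborel) (\<lambda>x. \<Prod>b\<in>Basis. f (inv e b) (x b))
      (\<Prod>b\<in>Basis. I (inv e b))"
  proof -
    have "integrable lborel (f i)" "integral\<^sup>L lborel (f i) = I i" for i
      using f[of i] by (simp_all add: has_bochner_integral_iff)
    then show ?thesis
      unfolding has_bochner_integral_iff
      using product_integrable_prod[of Basis "\<lambda>b. f (inv e b)"]
        product_integral_prod[of Basis "\<lambda>b. f (inv e b)"]
      by simp
  qed
  ultimately show ?thesis
    by (subst lborel_eq) (subst has_bochner_integral_distr, simp_all)
qed

definition std_gaussian :: "real^'n \<Rightarrow> real" where
  "std_gaussian z = (\<Prod>i\<in>UNIV. std_normal_density (z $ i))"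

lemma std_gaussian_eq:
  "std_gaussian z = exp (- (1/2) * (z \<bullet> z)) / sqrt (2 * pi) ^ CARD('n)" for z :: "real^'n"
  unfolding std_gaussian_def std_normal_density_def prod.distrib prod_constant exp_sum[OF finite, symmetric]
  by (simp add: inner_vec_def power2_eq_square sum_negf sum_divide_distrib power_divide)

lemma std_normal_low_moments:
  "has_bochner_integral lborel std_normal_density 1"
  "has_bochner_integral lborel (\<lambda>x. std_normal_density x * x) 0"
  "has_bochner_integral lborel (\<lambda>x. std_normal_density x * (x * x)) 1"
  using std_normal_moment_even[of 0] std_normal_moment_odd[of 0] std_normal_moment_even[of 1]
  by (simp_all add: power2_eq_square)

text \<open>Monomials of degree at most two times the density are products of functions of one coordinate,
  so that these moments reduce to the one-dimensional ones.\<close>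

lemma std_gaussian_moments:
  fixes a b :: "real^'n"
  shows "has_bochner_integral lborel (std_gaussian :: real^'n \<Rightarrow> real) 1"
    "has_bochner_integral lborel (\<lambda>z. std_gaussian z * (z \<bullet> a)) 0"
    "has_bochner_integral lborel (\<lambda>z. std_gaussian z * ((z \<bullet> a) * (z \<bullet> b))) (a \<bullet> b)"
proof -
  show "has_bochner_integral lborel (std_gaussian :: real^'n \<Rightarrow> real) 1"
    using has_bochner_integral_lborel_vec_prod[of "\<lambda>_. std_normal_density" "\<lambda>_::'n. 1"]
      std_normal_low_moments(1)
    by (simp add: std_gaussian_def[abs_def])
  have 1: "has_bochner_integral lborel (\<lambda>z. std_gaussian z * z $ i) 0" for i :: 'n
  proof -
    have "has_bochner_integral lborel (\<lambda>z::real^'n. \<Prod>k\<in>UNIV. std_normal_density (z $ k) * (if k = i then z $ k else 1))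
      (\<Prod>k\<in>UNIV. if k = i then 0 else 1)"
      by (rule has_bochner_integral_lborel_vec_prod[of "\<lambda>k x. std_normal_density x * (if k = i then x else 1)"])
        (use std_normal_low_moments in auto)
    then show ?thesis by (simp add: prod.distrib std_gaussian_def)
  qed
  have 2: "has_bochner_integral lborel (\<lambda>z. std_gaussian z * (z $ i * z $ j)) (of_bool (i = j))" for i j :: 'n
  proof -
    have "has_bochner_integral lborel (\<lambda>z::real^'n. \<Prod>k\<in>UNIV. std_normal_density (z $ k) *
        ((if k = i then z $ k else 1) * (if k = j then z $ k else 1)))
      (\<Prod>k\<in>UNIV. if k = i then of_bool (i = j) else if k = j then 0 else 1)"
      by (rule has_bochner_integral_lborel_vec_prod[of "\<lambda>k x. std_normal_density x * ((if k = i then x else 1) * (if k = j then x else 1))"])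
        (use std_normal_low_moments in auto)
    moreover have "(\<Prod>k\<in>UNIV. if k = i then of_bool (i = j) else if k = j then 0 else (1::real)) = of_bool (i = j)"
    proof (cases "i = j")
      case True
      then show ?thesis by (auto intro!: prod.neutral)
    qed (auto simp: prod_zero_iff intro!: exI[of _ i])
    ultimately show ?thesis by (simp add: prod.distrib std_gaussian_def)
  qed
  have "has_bochner_integral lborel (\<lambda>z. \<Sum>i\<in>UNIV. a $ i * (std_gaussian z * z $ i)) (\<Sum>i\<in>UNIV. a $ i * 0)"
    by (intro has_bochner_integral_sum has_bochner_integral_mult_right 1)
  then show "has_bochner_integral lborel (\<lambda>z. std_gaussian z * (z \<bullet> a)) 0"
    by (simp add: inner_vec_def sum_distrib_left ac_simps)
  have "has_bochner_integral lborel (\<lambda>z. \<Sum>i\<in>UNIV. \<Sum>j\<in>UNIV. (a $ i * b $ j) * (std_gaussian z * (z $ i * z $ j)))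
     (\<Sum>i\<in>UNIV. \<Sum>j\<in>UNIV. (a $ i * b $ j) * of_bool (i = j))"
    by (intro has_bochner_integral_sum has_bochner_integral_mult_right 2)
  moreover have "(\<Sum>i\<in>UNIV. \<Sum>j\<in>UNIV. (a $ i * b $ j) * of_bool (i = j)) = a \<bullet> b"
    by (simp add: inner_vec_def of_bool_def if_distrib cong: if_cong)
  moreover have "(\<Sum>i\<in>UNIV. \<Sum>j\<in>UNIV. (a $ i * b $ j) * (std_gaussian z * (z $ i * z $ j))) =
      std_gaussian z * ((z \<bullet> a) * (z \<bullet> b))" for z
  proof -
    have "std_gaussian z * ((z \<bullet> a) * (z \<bullet> b)) =
        std_gaussian z * (\<Sum>i\<in>UNIV. \<Sum>j\<in>UNIV. (z $ i * a $ i) * (z $ j * b $ j))"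
      by (simp add: inner_vec_def sum_product)
    also have "\<dots> = (\<Sum>i\<in>UNIV. \<Sum>j\<in>UNIV. std_gaussian z * ((z $ i * a $ i) * (z $ j * b $ j)))"
      by (simp only: sum_distrib_left)
    also have "\<dots> = (\<Sum>i\<in>UNIV. \<Sum>j\<in>UNIV. (a $ i * b $ j) * (std_gaussian z * (z $ i * z $ j)))"
      by (intro sum.cong refl) simp
    finally show ?thesis ..
  qed
  ultimately show "has_bochner_integral lborel (\<lambda>z. std_gaussian z * ((z \<bullet> a) * (z \<bullet> b))) (a \<bullet> b)"
    by simp
qed

lemma gaussian_density_measurable [measurable]: "gaussian_density m C \<in> borel_measurable borel"
  unfolding gaussian_density_def[abs_def]
  by measurable

text \<open>The substitution \<open>u = m + C\<^sup>1\<^sup>/\<^sup>2 z\<close> reduces every Gaussian integral to a standard one,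
  including the normalising constant, since \<open>det C\<close> is the square of \<open>det C\<^sup>1\<^sup>/\<^sup>2\<close>.\<close>

lemma gaussian_density_affine:
  fixes C :: "real^'n^'n"
  assumes C: "sym_pos_def C"
  shows "\<bar>det (matrix_sqrt C)\<bar> * gaussian_density m C (m + matrix_sqrt C *v z) = std_gaussian z"
proof -
  let ?S = "matrix_sqrt C" and ?R = "matrix_inv (matrix_sqrt C)"
  note S = matrix_sqrt_props[OF C]
  note R = matrix_inv_mult[OF sym_pos_def_invertible[OF S(1)]]
  have det: "det ?S \<noteq> 0" using sym_pos_def_invertible[OF S(1)] by (simp add: invertible_det_nz)
  have "C ** (?R ** ?R) = mat 1"
    by (metis S(2) R(1) matrix_mul_assoc matrix_mul_rid)
  then have "matrix_inv C = ?R ** ?R" by (rule matrix_inv_unique)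
  then have "(?S *v z) \<bullet> (matrix_inv C *v (?S *v z)) = (?S *v z) \<bullet> ((?R ** (?R ** ?S)) *v z)"
    by (simp add: matrix_vector_mul_assoc matrix_mul_assoc)
  also have "\<dots> = (?S *v z) \<bullet> (?R *v z)" by (simp add: R)
  also have "\<dots> = z \<bullet> (?S *v (?R *v z))" by (simp add: sym_pos_def_inner[OF S(1)])
  finally have q: "(?S *v z) \<bullet> (matrix_inv C *v (?S *v z)) = z \<bullet> z"
    by (simp add: matrix_vector_mul_assoc R)
  have eq: "det C = (det ?S)\<^sup>2" by (metis S(2) det_mul power2_eq_square)
  have "sqrt ((2 * pi) ^ CARD('n) * det C) = sqrt (2 * pi) ^ CARD('n) * \<bar>det ?S\<bar>"
    unfolding eq real_sqrt_mult[of "(2 * pi) ^ CARD('n)"] real_sqrt_abs real_sqrt_power[of "2 * pi"]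
    by (rule refl)
  then show ?thesis
    using det by (simp add: gaussian_density_def std_gaussian_eq q)
qed

lemma gaussian_density_pos:
  assumes "sym_pos_def C"
  shows "gaussian_density m C u > 0"
proof -
  have "det C = (det (matrix_sqrt C))\<^sup>2" by (metis matrix_sqrt_props(2)[OF assms] det_mul power2_eq_square)
  moreover have "det C \<noteq> 0" using sym_pos_def_invertible[OF assms] by (simp add: invertible_det_nz)
  ultimately have "det C > 0" by (metis zero_less_power2 power_zero_numeral)
  then show ?thesis by (simp add: gaussian_density_def)
qed

lemma gaussian_density_moments:
  fixes C :: "real^'n^'n"
  assumes C: "sym_pos_def C"
  shows "has_bochner_integral lborel (gaussian_density m C) 1"
    "has_bochner_integral lborel (\<lambda>u. gaussian_density m C u * ((u - m) \<bullet> a)) 0"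
    "has_bochner_integral lborel (\<lambda>u. gaussian_density m C u * (((u - m) \<bullet> a) * ((u - m) \<bullet> b))) (a \<bullet> (C *v b))"
proof -
  let ?S = "matrix_sqrt C"
  note S = matrix_sqrt_props[OF C]
  have det: "det ?S \<noteq> 0" using sym_pos_def_invertible[OF S(1)] by (simp add: invertible_det_nz)
  note intro = has_bochner_integral_affine_matrix[OF det, of _ m]
  note aff = gaussian_density_affine[OF C, of m]
  have Sa: "(?S *v z) \<bullet> v = z \<bullet> (?S *v v)" for z v
    by (simp add: sym_pos_def_inner[OF S(1)])
  have SS: "(?S *v a) \<bullet> (?S *v b) = a \<bullet> (C *v b)"
    by (metis Sa S(2) matrix_vector_mul_assoc)
  show "has_bochner_integral lborel (gaussian_density m C) 1"
    by (rule intro) (simp_all add: aff std_gaussian_moments)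
  show "has_bochner_integral lborel (\<lambda>u. gaussian_density m C u * ((u - m) \<bullet> a)) 0"
    by (rule intro)
      (simp_all add: aff Sa std_gaussian_moments flip: mult.assoc[of "abs (det ?S)"])
  show "has_bochner_integral lborel (\<lambda>u. gaussian_density m C u * (((u - m) \<bullet> a) * ((u - m) \<bullet> b))) (a \<bullet> (C *v b))"
  proof (rule intro)
    have "\<bar>det ?S\<bar> * (gaussian_density m C (m + ?S *v z) * (((m + ?S *v z - m) \<bullet> a) * ((m + ?S *v z - m) \<bullet> b)))
        = std_gaussian z * ((z \<bullet> (?S *v a)) * (z \<bullet> (?S *v b)))" for z
      unfolding aff[symmetric] by (simp add: Sa)
    then show "has_bochner_integral lborel (\<lambda>z. \<bar>det ?S\<bar> * (gaussian_density m C (m + ?S *v z) *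
        (((m + ?S *v z - m) \<bullet> a) * ((m + ?S *v z - m) \<bullet> b)))) (a \<bullet> (C *v b))"
      by (simp only: SS[symmetric] std_gaussian_moments(3))
  qed simp
qed

lemma has_bochner_integral_vec:
  fixes F :: "'a \<Rightarrow> 'b::euclidean_space^'n"
  assumes "\<And>i. has_bochner_integral M (\<lambda>x. F x $ i) (v $ i)"
  shows "has_bochner_integral M F v"
proof -
  have "bounded_linear (axis i :: 'b \<Rightarrow> 'b^'n)" for i
    unfolding linear_conv_bounded_linear[symmetric]
    by (rule linearI) (auto simp: axis_def vec_eq_iff)
  then have "has_bochner_integral M (\<lambda>x. axis i (F x $ i) :: 'b^'n) (axis i (v $ i))" for i
    using has_bochner_integral_bounded_linear assms by blast
  then have "has_bochner_integral M (\<lambda>x. \<Sum>i\<in>UNIV. axis i (F x $ i)) (\<Sum>i\<in>UNIV. axis i (v $ i))"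
    by (intro has_bochner_integral_sum)
  moreover have "(\<Sum>i\<in>UNIV. axis i (w $ i)) = w" for w :: "'b^'n"
    by (simp add: vec_eq_iff axis_def)
  ultimately show ?thesis by simp
qed

lemma gaussian_density_mean:
  fixes C :: "real^'n^'n"
  assumes C: "sym_pos_def C"
  shows "has_bochner_integral lborel (\<lambda>u. gaussian_density m C u *\<^sub>R u) m"
proof (rule has_bochner_integral_vec)
  fix i
  have "has_bochner_integral lborel (\<lambda>u. gaussian_density m C u * ((u - m) \<bullet> axis i 1) + gaussian_density m C u * m $ i) (0 + 1 * m $ i)"
    by (intro has_bochner_integral_add has_bochner_integral_mult_left gaussian_density_moments[OF C])
  then show "has_bochner_integral lborel (\<lambda>u. (gaussian_density m C u *\<^sub>R u) $ i) (m $ i)"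
    by (simp add: inner_axis algebra_simps)
qed

lemma gaussian_density_mean_linear:
  fixes C :: "real^'n^'n" and A :: "real^'n^'k"
  assumes C: "sym_pos_def C"
  shows "has_bochner_integral lborel (\<lambda>u. gaussian_density m C u *\<^sub>R (A *v u)) (A *v m)"
  using has_bochner_integral_bounded_linear[OF matrix_vector_mul_bounded_linear[of A] gaussian_density_mean[OF C, of m]]
  by (simp add: matrix_vector_mult_scaleR)

lemma gaussian_density_cov_linear:
  fixes C :: "real^'n^'n" and A :: "real^'n^'k"
  assumes C: "sym_pos_def C"
  shows "has_bochner_integral lborel
    (\<lambda>u. gaussian_density m C u *\<^sub>R outer (u - m) (A *v u - A *v m)) (C ** transpose A)"
proof (intro has_bochner_integral_vec)
  fix i j
  have "(gaussian_density m C u *\<^sub>R outer (u - m) (A *v u - A *v m)) $ i $ j =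
      gaussian_density m C u * (((u - m) \<bullet> axis i 1) * ((u - m) \<bullet> row j A))" for u
  proof -
    have "(A *v u - A *v m) $ j = (u - m) \<bullet> row j A"
      unfolding matrix_vector_mult_diff_distrib[symmetric]
      by (simp add: matrix_vector_mult_def row_def inner_vec_def mult.commute)
    then show ?thesis by (simp add: outer_def inner_axis)
  qed
  moreover have "(C ** transpose A) $ i $ j = axis i 1 \<bullet> (C *v row j A)"
    by (simp add: inner_axis' matrix_matrix_mult_def matrix_vector_mult_def row_def transpose_def)
  ultimately show "has_bochner_integral lborel
     (\<lambda>u. (gaussian_density m C u *\<^sub>R outer (u - m) (A *v u - A *v m)) $ i $ j) ((C ** transpose A) $ i $ j)"
    by (simp only: gaussian_density_moments(3)[OF C])
qed

lemma gaussian_density_covariance: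
  fixes C :: "real^'n^'n" and A :: "real^'n^'k"
  assumes C: "sym_pos_def C"
  shows "prob_density (gaussian_density m C)"
    "has_covariance (gaussian_density m C) (\<lambda>u. A *v u)"
    "cov_left (gaussian_density m C) (\<lambda>u. A *v u) = C ** transpose A"
proof -
  have mean: "mean (gaussian_density m C) = m"
    using gaussian_density_mean[OF C] unfolding mean_def by (rule has_bochner_integral_integral_eq)
  have mean_of: "mean_of (\<lambda>u. A *v u) (gaussian_density m C) = A *v m"
    using gaussian_density_mean_linear[OF C] unfolding mean_of_def
    by (rule has_bochner_integral_integral_eq)
  show "prob_density (gaussian_density m C)"
    using gaussian_density_moments(1)[OF C] gaussian_density_pos[OF C]
    by (simp add: prob_density_def has_bochner_integral_iff less_imp_le)
  show "has_covariance (gaussian_density m C) (\<lambda>u. A *v u)"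
    unfolding has_covariance_def mean mean_of
    by (intro conjI integrable.intros[OF gaussian_density_mean[OF C]]
        integrable.intros[OF gaussian_density_mean_linear[OF C]]
        integrable.intros[OF gaussian_density_cov_linear[OF C]])
  show "cov_left (gaussian_density m C) (\<lambda>u. A *v u) = C ** transpose A"
    using gaussian_density_cov_linear[OF C] unfolding cov_left_def mean mean_of
    by (rule has_bochner_integral_integral_eq)
qed

text \<open>Expand the quadratic form as a sum of products of two linear forms, one for each basis vector,
  and add the second moments.\<close>

lemma gaussian_density_quadratic:
  fixes B C :: "real^'n^'n"
  assumes C: "sym_pos_def C" and B: "\<And>x y. x \<bullet> (B *v y) = (B *v x) \<bullet> y"
  shows "has_bochner_integral lborel
    (\<lambda>u. gaussian_density m C u * ((u - m) \<bullet> (B *v (u - m)))) (trace (C ** B))"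
proof -
  have "x \<bullet> (B *v x) = (\<Sum>i\<in>UNIV. (x \<bullet> axis i 1) * (x \<bullet> (B *v axis i 1)))" for x
    by (simp add: B inner_axis) (simp add: inner_vec_def inner_axis mult.commute)
  then have "gaussian_density m C u * ((u - m) \<bullet> (B *v (u - m))) =
     (\<Sum>i\<in>UNIV. gaussian_density m C u * (((u - m) \<bullet> axis i 1) * ((u - m) \<bullet> (B *v axis i 1))))" for u
    by (simp add: sum_distrib_left)
  moreover have "trace (C ** B) = (\<Sum>i\<in>UNIV. axis i 1 \<bullet> (C *v (B *v axis i 1)))"
    unfolding trace_inner by (simp add: matrix_vector_mul_assoc)
  ultimately show ?thesis
    by (simp only:) (intro has_bochner_integral_sum gaussian_density_moments(3)[OF C])
qed

section \<open>Differentiation of the normalising constant\<close>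

text \<open>Provides the majorant \<open>\<Phi> u * p u\<close>, uniform in time, of the difference quotients of the tempered
  weights.\<close>

lemma exp_minus_lipschitz:
  fixes a b :: real
  assumes "0 \<le> a" "0 \<le> b"
  shows "\<bar>exp (- a) - exp (- b)\<bar> \<le> \<bar>a - b\<bar>"
proof -
  have *: "\<bar>exp (- a) - exp (- b)\<bar> \<le> b - a" if "0 \<le> a" "a \<le> b" for a b :: real
  proof -
    have "exp (- a) - exp (- b) = exp (- a) * (1 - exp (a - b))"
      by (simp add: algebra_simps flip: exp_add)
    moreover have "1 - exp (a - b) \<le> b - a" using exp_ge_add_one_self[of "a - b"] by linarith
    then have "exp (- a) * (1 - exp (a - b)) \<le> 1 * (b - a)"
      using that by (intro mult_mono) auto
    ultimately have "exp (- a) - exp (- b) \<le> b - a" by simp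
    then show ?thesis using that by simp
  qed
  show ?thesis
    using *[of a b] *[of b a] assms by (cases "a \<le> b") (auto simp: abs_minus_commute)
qed

context
  fixes \<Phi> p :: "'a::euclidean_space \<Rightarrow> real"
  assumes nn: "\<And>u. 0 \<le> \<Phi> u" and [measurable]: "\<Phi> \<in> borel_measurable borel"
    and p: "integrable lborel p" and \<Phi>p: "integrable lborel (\<lambda>u. \<Phi> u * p u)"
begin

lemma integrable_tempered: 
  assumes "t \<ge> 0"
  shows "integrable lborel (\<lambda>u. exp (- t * \<Phi> u) * p u)"
    "integrable lborel (\<lambda>u. exp (- t * \<Phi> u) * (\<Phi> u * p u))"
proof -
  have [measurable]: "p \<in> borel_measurable borel" using p by auto
  have 1: "exp (- (t * \<Phi> u)) \<le> 1" for u using assms nn[of u] by simp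
  show "integrable lborel (\<lambda>u. exp (- t * \<Phi> u) * p u)"
    by (rule Bochner_Integration.integrable_bound[OF p])
      (use 1 in \<open>auto simp: abs_mult intro!: mult_left_le_one_le\<close>)
  show "integrable lborel (\<lambda>u. exp (- t * \<Phi> u) * (\<Phi> u * p u))"
    by (rule Bochner_Integration.integrable_bound[OF \<Phi>p])
      (use 1 in \<open>auto simp: abs_mult intro!: mult_left_le_one_le\<close>)
qed

text \<open>Differentiation under the integral sign by dominated convergence. The derivative is one-sided
  at time zero, since for negative times the weight need not be integrable.\<close>

lemma tempered_const_has_derivative:
  assumes t: "t \<ge> 0"
  shows "((\<lambda>s. LINT u|lborel. exp (- s * \<Phi> u) * p u) has_real_derivative
    - (LINT u|lborel. exp (- t * \<Phi> u) * (\<Phi> u * p u))) (at t within {0..})"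
  unfolding has_field_derivative_iff tendsto_at_iff_sequentially
proof (intro allI impI)
  have [measurable]: "p \<in> borel_measurable borel" using p by auto
  fix X :: "nat \<Rightarrow> real" assume X: "\<forall>i. X i \<in> {0..} - {t}" "X \<longlonglongrightarrow> t"
  let ?Z = "\<lambda>s. LINT u|lborel. exp (- s * \<Phi> u) * p u"
  let ?f = "\<lambda>i u. (exp (- X i * \<Phi> u) - exp (- t * \<Phi> u)) / (X i - t) * p u"
  have Xn: "X i \<ge> 0" "X i \<noteq> t" for i using X(1) by auto
  have "(\<lambda>i. integral\<^sup>L lborel (?f i)) \<longlonglongrightarrow> (LINT u|lborel. - \<Phi> u * exp (- t * \<Phi> u) * p u)"
  proof (rule integral_dominated_convergence)
    show "integrable lborel (\<lambda>u. norm (\<Phi> u * p u))" using \<Phi>p by (rule integrable_norm)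
    show "AE u in lborel. (\<lambda>i. ?f i u) \<longlonglongrightarrow> - \<Phi> u * exp (- t * \<Phi> u) * p u"
    proof (intro AE_I2 tendsto_mult tendsto_const)
      fix u
      have "((\<lambda>s. exp (- s * \<Phi> u)) has_real_derivative - \<Phi> u * exp (- t * \<Phi> u)) (at t within {0..})"
        by (auto intro!: derivative_eq_intros)
      then show "(\<lambda>i. (exp (- X i * \<Phi> u) - exp (- t * \<Phi> u)) / (X i - t)) \<longlonglongrightarrow> - \<Phi> u * exp (- t * \<Phi> u)"
        using X unfolding has_field_derivative_iff tendsto_at_iff_sequentially by (auto simp: o_def)
    qed
    show "AE u in lborel. norm (?f i u) \<le> norm (\<Phi> u * p u)" for i
    proof (rule AE_I2)
      fix u
      have "\<bar>exp (- (X i * \<Phi> u)) - exp (- (t * \<Phi> u))\<bar> \<le> \<bar>X i * \<Phi> u - t * \<Phi> u\<bar>"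
        using Xn[of i] t nn[of u] by (intro exp_minus_lipschitz) auto
      also have "\<dots> = \<Phi> u * \<bar>X i - t\<bar>"
        using nn[of u] by (simp add: abs_mult flip: left_diff_distrib)
      finally have "\<bar>exp (- X i * \<Phi> u) - exp (- t * \<Phi> u)\<bar> / \<bar>X i - t\<bar> \<le> \<Phi> u"
        using Xn[of i] by (simp add: divide_simps)
      then have "\<bar>exp (- X i * \<Phi> u) - exp (- t * \<Phi> u)\<bar> / \<bar>X i - t\<bar> * \<bar>p u\<bar> \<le> \<Phi> u * \<bar>p u\<bar>"
        by (rule mult_right_mono) simp
      then show "norm (?f i u) \<le> norm (\<Phi> u * p u)"
        using nn[of u] by (simp add: abs_mult)
    qed
  qed measurable
  moreover have "integral\<^sup>L lborel (?f i) = (?Z (X i) - ?Z t) / (X i - t)" for i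
  proof -
    have "integral\<^sup>L lborel (?f i) =
        (LINT u|lborel. (exp (- X i * \<Phi> u) * p u - exp (- t * \<Phi> u) * p u) / (X i - t))"
      by (simp add: left_diff_distrib)
    also have "\<dots> = (?Z (X i) - ?Z t) / (X i - t)"
      using integrable_tempered(1)[OF Xn(1)[of i]] integrable_tempered(1)[OF t]
      by (simp add: Bochner_Integration.integral_diff)
    finally show ?thesis .
  qed
  moreover have "(LINT u|lborel. - \<Phi> u * exp (- t * \<Phi> u) * p u) =
      - (LINT u|lborel. exp (- t * \<Phi> u) * (\<Phi> u * p u))"
    by (simp add: ac_simps)
  ultimately show "((\<lambda>s. (?Z s - ?Z t) / (s - t)) \<circ> X) \<longlonglongrightarrow>
      - (LINT u|lborel. exp (- t * \<Phi> u) * (\<Phi> u * p u))"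
    by (simp only: o_def)
qed

lemma continuous_on_tempered_const_derivative:
  "continuous_on {0..} (\<lambda>t. LINT u|lborel. exp (- t * \<Phi> u) * (\<Phi> u * p u))"
  unfolding continuous_on_sequentially
proof (intro allI ballI impI, elim conjE)
  have [measurable]: "p \<in> borel_measurable borel" using p by auto
  fix X :: "nat \<Rightarrow> real" and t assume X: "\<forall>i. X i \<in> {0..}" "X \<longlonglongrightarrow> t"
  have "(\<lambda>i. LINT u|lborel. exp (- X i * \<Phi> u) * (\<Phi> u * p u)) \<longlonglongrightarrow>
      (LINT u|lborel. exp (- t * \<Phi> u) * (\<Phi> u * p u))"
  proof (rule integral_dominated_convergence)
    show "integrable lborel (\<lambda>u. norm (\<Phi> u * p u))" using \<Phi>p by (rule integrable_norm)
    show "AE u in lborel. (\<lambda>i. exp (- X i * \<Phi> u) * (\<Phi> u * p u)) \<longlonglongrightarrow> exp (- t * \<Phi> u) * (\<Phi> u * p u)"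
      by (intro AE_I2 tendsto_intros X)
    show "AE u in lborel. norm (exp (- X i * \<Phi> u) * (\<Phi> u * p u)) \<le> norm (\<Phi> u * p u)" for i
    proof (rule AE_I2)
      fix u
      have "exp (- X i * \<Phi> u) \<le> 1" using X nn[of u] by auto
      then show "norm (exp (- X i * \<Phi> u) * (\<Phi> u * p u)) \<le> norm (\<Phi> u * p u)"
        unfolding norm_mult[of "exp _"] by (intro mult_left_le_one_le) auto
    qed
  qed measurable
  then show "((\<lambda>t. LINT u|lborel. exp (- t * \<Phi> u) * (\<Phi> u * p u)) \<circ> X) \<longlonglongrightarrow>
      (LINT u|lborel. exp (- t * \<Phi> u) * (\<Phi> u * p u))"
    by (simp add: o_def)
qed

end

section \<open>Matrix calculus\<close>

lemma outer_mult_vec: "outer a b *v h = (b \<bullet> h) *\<^sub>R a"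
  by (simp add: outer_def vec_eq_iff matrix_vector_mult_def inner_vec_def sum_distrib_left ac_simps)

lemma trace_outer: "trace (outer a b) = a \<bullet> b"
  by (simp add: trace_def outer_def inner_vec_def)

lemma matrix_scaleR_vec: "(c *\<^sub>R M) *v x = c *\<^sub>R (M *v x)" for M :: "real^'n^'m"
  by (simp add: scaleR_matrix_vector_assoc)

lemma has_derivative_matrix_mult [derivative_intros]:
  fixes M :: "real^'n^'m"
  shows "(f has_derivative f') F \<Longrightarrow> ((\<lambda>x. M *v f x) has_derivative (\<lambda>h. M *v f' h)) F"
  by (rule bounded_linear.has_derivative[OF matrix_vector_mul_bounded_linear])

lemma continuous_on_matrix_mult [continuous_intros]:
  fixes M :: "real^'n^'m"
  shows "continuous_on S f \<Longrightarrow> continuous_on S (\<lambda>x. M *v f x)"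
  by (rule bounded_linear.continuous_on[OF matrix_vector_mul_bounded_linear])

lemma jacobianI:
  fixes f :: "real^'n \<Rightarrow> real^'m"
  assumes "(f has_derivative (\<lambda>h. M *v h)) (at u)"
  shows "jacobian f (at u) = M"
  unfolding jacobian_def frechet_derivative_at[OF assms, symmetric]
  by (rule matrix_of_matrix_vector_mul)

lemma gradientI: "GDERIV f u :> D \<Longrightarrow> gradient f u = D"
  unfolding gderiv_def gradient_def
  by (auto simp: vec_eq_iff inner_axis' dest!: frechet_derivative_at[symmetric])

lemma inner_transpose_mult: "x \<bullet> (transpose A *v z) = (A *v x) \<bullet> z" for A :: "real^'n^'k"
  by (metis dot_lmul_matrix inner_commute transpose_matrix_vector)

lemma symmetric_congruence:
  fixes A :: "real^'n^'k" and N :: "real^'k^'k"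
  assumes "\<And>x y. x \<bullet> (N *v y) = (N *v x) \<bullet> y"
  shows "x \<bullet> ((transpose A ** N ** A) *v y) = ((transpose A ** N ** A) *v x) \<bullet> y"
    "x \<bullet> ((transpose A ** N ** A) *v y) = (A *v x) \<bullet> (N *v (A *v y))"
proof -
  show 2: "x \<bullet> ((transpose A ** N ** A) *v y) = (A *v x) \<bullet> (N *v (A *v y))" for x y
    by (simp only: inner_transpose_mult matrix_vector_mul_assoc[symmetric])
  show "x \<bullet> ((transpose A ** N ** A) *v y) = ((transpose A ** N ** A) *v x) \<bullet> y"
    by (metis 2 assms inner_commute)
qed

section \<open>Tempered densities of a linear Gaussian problem\<close>

text \<open>The tempered weight is \<open>exp (- q t u)\<close> up to a constant, where \<open>q t\<close> is a quadratic polynomial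
  with Hessian \<open>P t\<close> and gradient \<open>w t\<close>. The loss has gradient \<open>- g\<close> and Hessian \<open>B\<close>. The point \<open>m t\<close>, where \<open>w t\<close> vanishes, and \<open>C t = (P t)\<^sup>-\<^sup>1\<close> are the mean and covariance of
  the tempered density.\<close>

locale linear_gaussian =
  fixes A :: "real^'l^'k" and \<Gamma> :: "real^'k^'k" and y :: "real^'k"
    and m0 :: "real^'l" and C0 :: "real^'l^'l"
  assumes \<Gamma>: "sym_pos_def \<Gamma>" and C0: "sym_pos_def C0"
begin

abbreviation N :: "real^'k^'k" where "N \<equiv> matrix_inv \<Gamma>"
abbreviation P0 :: "real^'l^'l" where "P0 \<equiv> matrix_inv C0"
abbreviation \<mu>0 :: "real^'l \<Rightarrow> real" where "\<mu>0 \<equiv> gaussian_density m0 C0"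
abbreviation \<Phi> :: "real^'l \<Rightarrow> real" where "\<Phi> \<equiv> loss \<Gamma> (\<lambda>u. A *v u) y"

definition B :: "real^'l^'l" where "B = transpose A ** N ** A"
definition P :: "real \<Rightarrow> real^'l^'l" where "P t = P0 + t *\<^sub>R B"
definition C :: "real \<Rightarrow> real^'l^'l" where "C t = matrix_inv (P t)"
definition g :: "real^'l \<Rightarrow> real^'l" where "g u = transpose A *v (N *v (y - A *v u))"
definition w :: "real \<Rightarrow> real^'l \<Rightarrow> real^'l" where "w t u = P0 *v (u - m0) - t *\<^sub>R g u"
definition m :: "real \<Rightarrow> real^'l" where "m t = - (C t *v w t 0)"
definition q :: "real \<Rightarrow> real^'l \<Rightarrow> real" where
  "q t u = t * \<Phi> u + 1/2 * ((u - m0) \<bullet> (P0 *v (u - m0)))"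

lemma N_sym: "a \<bullet> (N *v b) = (N *v a) \<bullet> b"
  by (rule sym_pos_def_inner[OF sym_pos_def_inverse[OF \<Gamma>]])

lemma P0_sym: "a \<bullet> (P0 *v b) = (P0 *v a) \<bullet> b"
  by (rule sym_pos_def_inner[OF sym_pos_def_inverse[OF C0]])

lemma B_sym: "a \<bullet> (B *v b) = (B *v a) \<bullet> b"
  unfolding B_def by (rule symmetric_congruence(1)[OF N_sym])

lemma B_inner: "a \<bullet> (B *v b) = (A *v a) \<bullet> (N *v (A *v b))"
  unfolding B_def by (rule symmetric_congruence(2)[OF N_sym])

lemma B_nonneg: "a \<bullet> (B *v a) \<ge> 0"
  unfolding B_inner by (rule sym_pos_def_nonneg[OF sym_pos_def_inverse[OF \<Gamma>]])

lemma P_apply: "P t *v x = P0 *v x + t *\<^sub>R (B *v x)"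
  by (simp add: P_def matrix_vector_mult_add_rdistrib matrix_scaleR_vec)

lemma P_spd:
  assumes "t \<ge> 0"
  shows "sym_pos_def (P t)"
proof (rule sym_pos_defI)
  show "a \<bullet> (P t *v b) = (P t *v a) \<bullet> b" for a b
    by (simp add: P_apply inner_add_left inner_add_right P0_sym B_sym)
  show "a \<bullet> (P t *v a) > 0" if "a \<noteq> 0" for a
  proof -
    have "a \<bullet> (P0 *v a) > 0" using sym_pos_def_inverse[OF C0] that by (simp add: sym_pos_def_def)
    then show ?thesis using B_nonneg[of a] assms by (simp add: P_apply inner_add_right add_pos_nonneg)
  qed
qed

lemma C_spd: "t \<ge> 0 \<Longrightarrow> sym_pos_def (C t)"
  unfolding C_def by (intro sym_pos_def_inverse P_spd)

lemma CP: "t \<ge> 0 \<Longrightarrow> C t ** P t = mat 1" "t \<ge> 0 \<Longrightarrow> P t ** C t = mat 1"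
  unfolding C_def by (intro matrix_inv_mult sym_pos_def_invertible P_spd; assumption)+

lemma C_inv: "t \<ge> 0 \<Longrightarrow> matrix_inv (C t) = P t"
  by (intro matrix_inv_unique CP)

lemma loss_expand: "\<Phi> (v + e) = \<Phi> v - e \<bullet> g v + 1/2 * (e \<bullet> (B *v e))"
proof -
  have d: "y - A *v (v + e) = (y - A *v v) - A *v e"
    by (simp add: matrix_vector_right_distrib)
  have "e \<bullet> g v = (A *v e) \<bullet> (N *v (y - A *v v))"
    unfolding g_def by (rule inner_transpose_mult)
  moreover have "(y - A *v v) \<bullet> (N *v (A *v e)) = (A *v e) \<bullet> (N *v (y - A *v v))"
    by (metis N_sym inner_commute)
  ultimately show ?thesis
    unfolding loss_eq[OF \<Gamma>] d B_inner
    by (simp add: matrix_vector_mult_diff_distrib inner_diff_left inner_diff_right algebra_simps)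
qed

lemma loss_nonneg: "\<Phi> u \<ge> 0"
  unfolding loss_eq[OF \<Gamma>] using sym_pos_def_nonneg[OF sym_pos_def_inverse[OF \<Gamma>]] by simp

lemma loss_continuous [continuous_intros]:
  "continuous_on S f \<Longrightarrow> continuous_on S (\<lambda>x. \<Phi> (f x))"
  unfolding loss_eq[OF \<Gamma>] by (intro continuous_intros)

lemma loss_measurable [measurable]: "\<Phi> \<in> borel_measurable borel"
  by (intro borel_measurable_continuous_onI continuous_intros)

lemma q_expand: "q t (v + e) = q t v + e \<bullet> w t v + 1/2 * (e \<bullet> (P t *v e))"
proof -
  have d: "v + e - m0 = (v - m0) + e" by simp
  have "(v - m0) \<bullet> (P0 *v e) = e \<bullet> (P0 *v (v - m0))" by (metis P0_sym inner_commute)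
  then show ?thesis
    unfolding q_def w_def loss_expand d P_apply
    by (simp add: matrix_vector_right_distrib inner_add_left inner_add_right inner_diff_right algebra_simps)
qed

lemma w_shift: "w t (u + h) = w t u + P t *v h"
  by (simp add: w_def g_def P_apply B_def matrix_vector_right_distrib matrix_vector_mult_diff_distrib
      algebra_simps flip: matrix_vector_mul_assoc)

lemma w_eq: "t \<ge> 0 \<Longrightarrow> w t u = P t *v (u - m t)"
  using w_shift[of t 0 u]
  by (simp add: m_def matrix_vector_right_distrib matrix_vector_mul_assoc CP)

lemma w_m: "t \<ge> 0 \<Longrightarrow> w t (m t) = 0"
  by (simp add: w_eq)

lemma C_w: "t \<ge> 0 \<Longrightarrow> C t *v w t u = u - m t"
  by (simp add: w_eq matrix_vector_mul_assoc CP)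

definition Z :: "real \<Rightarrow> real" where "Z = tempered_const \<Phi> \<mu>0"
definition \<rho> :: "real \<Rightarrow> real^'l \<Rightarrow> real" where "\<rho> = tempered_density \<Phi> \<mu>0"

lemma weight_eq: "exp (- t * \<Phi> u) * \<mu>0 u = exp (- q t u) / sqrt ((2 * pi) ^ CARD('l) * det C0)"
proof -
  have "exp (- t * \<Phi> u) * exp (- (1/2) * ((u - m0) \<bullet> (P0 *v (u - m0)))) = exp (- q t u)"
    unfolding exp_add[symmetric] by (simp add: q_def)
  then show ?thesis by (simp add: gaussian_density_def)
qed

text \<open>Completing the square around \<open>m t\<close>. The constant is found by evaluating both sides at \<open>m t\<close>.\<close>

lemma weight_gaussian:
  assumes t: "t \<ge> 0"
  obtains K where "K > 0" "\<And>u. exp (- t * \<Phi> u) * \<mu>0 u = K * gaussian_density (m t) (C t) u"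
proof -
  define K where "K = exp (- t * \<Phi> (m t)) * \<mu>0 (m t) / gaussian_density (m t) (C t) (m t)"
  have "exp (- t * \<Phi> u) * \<mu>0 u = K * gaussian_density (m t) (C t) u" for u
  proof -
  have "q t u = q t (m t) + 1/2 * ((u - m t) \<bullet> (P t *v (u - m t)))"
    using q_expand[of t "m t" "u - m t"] by (simp add: w_m t)
  then have "exp (- q t u) = exp (- q t (m t)) * exp (- (1/2) * ((u - m t) \<bullet> (P t *v (u - m t))))"
    by (simp flip: exp_add)
  moreover have "gaussian_density (m t) (C t) u / gaussian_density (m t) (C t) (m t) =
      exp (- (1/2) * ((u - m t) \<bullet> (P t *v (u - m t))))"
    using sym_pos_def_invertible[OF C_spd[OF t]]
    by (simp add: gaussian_density_def C_inv t invertible_det_nz)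
  ultimately have "exp (- q t u) = exp (- q t (m t)) *
      (gaussian_density (m t) (C t) u / gaussian_density (m t) (C t) (m t))"
    by simp
  then show ?thesis unfolding weight_eq K_def by simp
  qed
  moreover have "K > 0"
    by (simp add: K_def gaussian_density_pos C0 C_spd t)
  ultimately show ?thesis by (rule that[rotated])
qed

text \<open>The Gaussian density has integral one, which identifies the constant of the completed square with
  the normalising constant \<open>Z t\<close>.\<close>

lemma \<rho>_gaussian:
  assumes t: "t \<ge> 0"
  shows "Z t > 0" "\<rho> t = gaussian_density (m t) (C t)"
proof -
  obtain K where K: "K > 0" "\<And>u. exp (- t * \<Phi> u) * \<mu>0 u = K * gaussian_density (m t) (C t) u"
    using weight_gaussian[OF t] by blast
  have "Z t = (LINT u|lborel. K * gaussian_density (m t) (C t) u)"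
    unfolding Z_def tempered_const_def K(2) ..
  also have "\<dots> = K"
    using gaussian_density_moments(1)[OF C_spd[OF t], of "m t"] by (simp add: has_bochner_integral_iff)
  finally have Z: "Z t = K" .
  then show "Z t > 0" using K by simp
  show "\<rho> t = gaussian_density (m t) (C t)"
    unfolding \<rho>_def tempered_density_def K(2) Z_def[symmetric] Z
    using K(1) by auto
qed

lemma \<rho>_eq: "\<rho> t u = exp (- q t u) / (Z t * sqrt ((2 * pi) ^ CARD('l) * det C0))"
  unfolding \<rho>_def tempered_density_def weight_eq Z_def by simp

lemma \<rho>_0: "\<rho> 0 u = \<mu>0 u"
  using gaussian_density_moments(1)[OF C0, of m0]
  by (simp add: \<rho>_def tempered_density_def tempered_const_def has_bochner_integral_iff)

definition D where "D t u = - (\<rho> t u *\<^sub>R w t u)"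
definition H where "H t u = \<rho> t u *\<^sub>R (outer (w t u) (w t u) - P t)"

lemma w_has_derivative: "(w t has_derivative (\<lambda>h. P t *v h)) (at u)"
proof -
  have eq: "w t v = w t u + P t *v (v - u)" for v using w_shift[of t u "v - u"] by simp
  have "((\<lambda>v. w t u + P t *v (v - u)) has_derivative (\<lambda>h. P t *v h)) (at u)"
    by (auto intro!: derivative_eq_intros)
  then show ?thesis by (simp only: eq[symmetric])
qed

lemma \<rho>_has_derivative: "(\<rho> t has_derivative (\<lambda>h. h \<bullet> D t u)) (at u)"
proof -
  have eq: "q t v = q t u + (v - u) \<bullet> w t u + 1/2 * ((v - u) \<bullet> (P t *v (v - u)))" for v
    using q_expand[of t u "v - u"] by simp
  have "((\<lambda>v. q t u + (v - u) \<bullet> w t u + 1/2 * ((v - u) \<bullet> (P t *v (v - u)))) has_derivative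
      (\<lambda>h. h \<bullet> w t u)) (at u)"
    by (auto intro!: derivative_eq_intros)
  then have q: "(q t has_derivative (\<lambda>h. h \<bullet> w t u)) (at u)" by (simp only: eq[symmetric])
  have "((\<lambda>v. exp (- q t v) / (Z t * sqrt ((2 * pi) ^ CARD('l) * det C0)))
     has_derivative (\<lambda>h. h \<bullet> D t u)) (at u)"
    unfolding divide_inverse
    by (rule derivative_eq_intros q refl)+ (simp add: D_def \<rho>_eq divide_inverse fun_eq_iff)
  then show ?thesis by (simp only: \<rho>_eq[symmetric])
qed

lemma \<rho>_GDERIV: "GDERIV (\<rho> t) u :> D t u"
  unfolding gderiv_def by (rule \<rho>_has_derivative)

lemma D_has_derivative: "(D t has_derivative (\<lambda>h. H t u *v h)) (at u)"
  unfolding D_def[abs_def]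
  by (rule derivative_eq_intros \<rho>_has_derivative w_has_derivative refl)+
    (simp add: fun_eq_iff H_def D_def matrix_scaleR_vec matrix_vector_mult_diff_rdistrib outer_mult_vec
      inner_commute algebra_simps)

lemma hessian_\<rho>: "hessian (\<rho> t) u = H t u"
proof -
  have "gradient (\<rho> t) = D t" using gradientI[OF \<rho>_GDERIV] by blast
  then show ?thesis unfolding hessian_def by (simp add: jacobianI[OF D_has_derivative])
qed

lemma cov_left_\<rho>: "t \<ge> 0 \<Longrightarrow> cov_left (\<rho> t) (\<lambda>u. A *v u) = C t ** transpose A"
  by (simp add: \<rho>_gaussian gaussian_density_covariance(3)[OF C_spd])

lemma flux_\<rho>:
  assumes "t \<ge> 0"
  shows "flux (\<lambda>u. A *v u) \<Gamma> y (\<rho> t) u = \<rho> t u *\<^sub>R (C t *v g u)"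
proof -
  have "transpose N = N" using sym_pos_def_inverse[OF \<Gamma>] by (simp add: sym_pos_def_def)
  then have "x v* (N ** transpose (C t ** transpose A)) = C t *v (transpose A *v (N *v x))" for x
    by (simp add: matrix_transpose_mul matrix_vector_mul_assoc matrix_mul_assoc flip: transpose_matrix_vector)
  then show ?thesis
    by (simp add: flux_def cov_right_def cov_left_\<rho>[OF assms] g_def)
qed

lemma g_shift: "g (u + h) = g u - B *v h"
  by (simp add: g_def B_def matrix_vector_right_distrib matrix_vector_mult_diff_distrib
      diff_diff_eq[symmetric] flip: matrix_vector_mul_assoc)

text \<open>The product rule for \<open>\<rho> * C g\<close>: the Jacobian consists of the rank-one part from \<open>\<rho>\<close> and of
  \<open>- \<rho> C B\<close>, as \<open>- B\<close> is the Jacobian of \<open>g\<close>.\<close>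

lemma flux_has_derivative:
  assumes t: "t \<ge> 0"
  shows "(flux (\<lambda>u. A *v u) \<Gamma> y (\<rho> t) has_derivative
    (\<lambda>h. (outer (C t *v g u) (D t u) - \<rho> t u *\<^sub>R (C t ** B)) *v h)) (at u)"
proof -
  have eq: "g v = g u - B *v (v - u)" for v using g_shift[of u "v - u"] by simp
  have "((\<lambda>v. g u - B *v (v - u)) has_derivative (\<lambda>h. - (B *v h))) (at u)"
    by (auto intro!: derivative_eq_intros)
  then have g: "(g has_derivative (\<lambda>h. - (B *v h))) (at u)" by (simp only: eq[symmetric])
  have "((\<lambda>v. \<rho> t v *\<^sub>R (C t *v g v)) has_derivative
    (\<lambda>h. (outer (C t *v g u) (D t u) - \<rho> t u *\<^sub>R (C t ** B)) *v h)) (at u)"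
    by (rule derivative_eq_intros \<rho>_has_derivative g refl)+
      (simp add: fun_eq_iff matrix_scaleR_vec matrix_vector_mult_diff_rdistrib outer_mult_vec
        inner_commute linear_neg[OF matrix_vector_mul_linear] flip: matrix_vector_mul_assoc)
  then show ?thesis by (simp only: flux_\<rho>[OF t, symmetric])
qed

end

section \<open>The Fokker-Planck equation\<close>

context linear_gaussian
begin

lemma expected_loss:
  assumes t: "t \<ge> 0"
  shows "has_bochner_integral lborel (\<lambda>u. \<rho> t u * \<Phi> u) (\<Phi> (m t) + 1/2 * trace (C t ** B))"
proof -
  note spd = C_spd[OF t]
  have "\<rho> t u * \<Phi> u = gaussian_density (m t) (C t) u * \<Phi> (m t)
      - gaussian_density (m t) (C t) u * ((u - m t) \<bullet> g (m t))
      + gaussian_density (m t) (C t) u * ((u - m t) \<bullet> (B *v (u - m t))) * (1/2)" for u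
  proof -
    have "\<Phi> u = \<Phi> (m t) - (u - m t) \<bullet> g (m t) + 1/2 * ((u - m t) \<bullet> (B *v (u - m t)))"
      using loss_expand[of "m t" "u - m t"] by simp
    then show ?thesis by (simp add: \<rho>_gaussian(2)[OF t] distrib_left right_diff_distrib)
  qed
  moreover have "has_bochner_integral lborel (\<lambda>u. gaussian_density (m t) (C t) u * \<Phi> (m t)
      - gaussian_density (m t) (C t) u * ((u - m t) \<bullet> g (m t))
      + gaussian_density (m t) (C t) u * ((u - m t) \<bullet> (B *v (u - m t))) * (1/2))
      (1 * \<Phi> (m t) - 0 + trace (C t ** B) * (1/2))"
    by (intro has_bochner_integral_add has_bochner_integral_diff has_bochner_integral_mult_left
        gaussian_density_moments(1,2)[OF spd] gaussian_density_quadratic[OF spd B_sym])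
  ultimately show ?thesis by simp
qed

definition Z' :: "real \<Rightarrow> real" where "Z' t = - (LINT u|lborel. exp (- t * \<Phi> u) * (\<Phi> u * \<mu>0 u))"

lemma Z_eq: "Z = (\<lambda>t. LINT u|lborel. exp (- t * \<Phi> u) * \<mu>0 u)"
  by (simp add: Z_def tempered_const_def fun_eq_iff)

lemma prior_integrable: "integrable lborel \<mu>0" "integrable lborel (\<lambda>u. \<Phi> u * \<mu>0 u)"
proof -
  show "integrable lborel \<mu>0" using gaussian_density_moments(1)[OF C0] by (rule integrable.intros)
  have "(\<lambda>u. \<rho> 0 u * \<Phi> u) = (\<lambda>u. \<Phi> u * \<mu>0 u)" by (simp add: \<rho>_0 mult.commute)
  then show "integrable lborel (\<lambda>u. \<Phi> u * \<mu>0 u)"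
    using integrable.intros[OF expected_loss[of 0]] by simp
qed

lemma Z_has_derivative: "t \<ge> 0 \<Longrightarrow> (Z has_real_derivative Z' t) (at t within {0..})"
  unfolding Z_eq Z'_def
  by (rule tempered_const_has_derivative[OF loss_nonneg loss_measurable prior_integrable])

lemma Z_continuous: "continuous_on {0..} Z"
  by (rule DERIV_continuous_on) (use Z_has_derivative in auto)

lemma Z'_continuous: "continuous_on {0..} Z'"
  unfolding Z'_def[abs_def]
  by (intro continuous_intros
      continuous_on_tempered_const_derivative[OF loss_nonneg loss_measurable prior_integrable])

text \<open>The tempered weight is \<open>Z t\<close> times the density, which turns the integral defining \<open>Z' t\<close> into an
  expectation under \<open>\<rho> t\<close>.\<close>

lemma Z'_eq:
  assumes t: "t \<ge> 0"
  shows "Z' t = - (Z t * (\<Phi> (m t) + 1/2 * trace (C t ** B)))"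
proof -
  have "exp (- t * \<Phi> u) * (\<Phi> u * \<mu>0 u) = Z t * (\<rho> t u * \<Phi> u)" for u
    using \<rho>_gaussian(1)[OF t] by (simp add: \<rho>_def tempered_density_def Z_def)
  then have "Z' t = - (LINT u|lborel. Z t * (\<rho> t u * \<Phi> u))"
    by (simp only: Z'_def)
  then show ?thesis
    using expected_loss[OF t] by (simp add: has_bochner_integral_iff)
qed

definition \<rho>' :: "real \<Rightarrow> real^'l \<Rightarrow> real" where "\<rho>' t u = \<rho> t u * (- \<Phi> u - Z' t / Z t)"

lemma \<rho>_time_derivative:
  assumes t: "t \<ge> 0"
  shows "((\<lambda>s. \<rho> s u) has_real_derivative \<rho>' t u) (at t within {0..})"
proof -
  have "((\<lambda>s. 1 / Z s * (exp (- s * \<Phi> u) * \<mu>0 u)) has_real_derivative \<rho>' t u) (at t within {0..})"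
    using \<rho>_gaussian(1)[OF t]
    by (auto intro!: derivative_eq_intros Z_has_derivative t
        simp: \<rho>'_def \<rho>_def tempered_density_def field_simps simp flip: Z_def)
  then show ?thesis by (simp add: \<rho>_def tempered_density_def Z_def)
qed

text \<open>With \<open>e = u - m t\<close>, so that \<open>C w = e\<close>, the drift contributes
  \<open>\<rho> (e \<bullet> g u + tr (C B))\<close> and the diffusion \<open>1/2 \<rho> (e \<bullet> B e - tr (C B))\<close>. The time derivative is
  \<open>\<rho>\<close> times the expected minus the actual loss, that is \<open>\<Phi> (m t) + 1/2 tr (C B) - \<Phi> u\<close>, and
  the expansion of the loss around \<open>u\<close> shows that the two sides agree.\<close>

lemma fokker_planck_\<rho>:
  assumes t: "t \<ge> 0"
  shows "fokker_planck_rhs (\<lambda>u. A *v u) \<Gamma> y (\<rho> t) u = \<rho>' t u"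
proof -
  define e where "e = u - m t"
  let ?CB = "C t ** B"
  note spd = C_spd[OF t]
  have Cw: "C t *v w t u = e" by (simp add: e_def C_w t)
  have Csym: "x \<bullet> (C t *v z) = (C t *v x) \<bullet> z" for x z by (rule sym_pos_def_inner[OF spd])
  have wC: "w t u \<bullet> (C t *v z) = e \<bullet> z" for z by (simp add: Csym Cw)
  have "divergence (flux (\<lambda>u. A *v u) \<Gamma> y (\<rho> t)) u =
      (C t *v g u) \<bullet> D t u - \<rho> t u * trace ?CB"
    unfolding divergence_def jacobianI[OF flux_has_derivative[OF t]]
    by (simp add: trace_sub trace_outer) (simp add: trace_def sum_distrib_left)
  also have "(C t *v g u) \<bullet> D t u = - (\<rho> t u * (e \<bullet> g u))"
    by (simp add: D_def inner_commute[of "C t *v g u"] wC)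
  finally have div: "divergence (flux (\<lambda>u. A *v u) \<Gamma> y (\<rho> t)) u =
      - \<rho> t u * (e \<bullet> g u + trace ?CB)"
    by (simp add: algebra_simps)
  have M: "cov_left (\<rho> t) (\<lambda>u. A *v u) ** matrix_inv \<Gamma> ** cov_right (\<lambda>u. A *v u) (\<rho> t) = C t ** B ** C t"
  proof -
    have "transpose (C t) = C t" using spd by (simp add: sym_pos_def_def)
    then show ?thesis
      by (simp add: cov_right_def cov_left_\<rho>[OF t] matrix_transpose_mul B_def matrix_mul_assoc)
  qed
  have "C t ** B ** C t ** H t u = \<rho> t u *\<^sub>R (outer (C t *v (B *v e)) (w t u) - ?CB)"
  proof (rule matrix_eq[THEN iffD2], rule allI)
    fix x
    have CPx: "C t *v (P t *v x) = x" by (simp add: matrix_vector_mul_assoc CP t)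
    show "(C t ** B ** C t ** H t u) *v x = (\<rho> t u *\<^sub>R (outer (C t *v (B *v e)) (w t u) - ?CB)) *v x"
      by (simp add: H_def matrix_scaleR_vec matrix_vector_mult_diff_rdistrib outer_mult_vec
          matrix_vector_mult_diff_distrib matrix_vector_mult_scaleR Cw CPx
          flip: matrix_vector_mul_assoc)
  qed
  then have "trace (C t ** B ** C t ** H t u) = \<rho> t u * trace (outer (C t *v (B *v e)) (w t u) - ?CB)"
    by (simp add: trace_def sum_distrib_left)
  also have "\<dots> = \<rho> t u * (e \<bullet> (B *v e) - trace ?CB)"
    by (simp add: trace_sub trace_outer inner_commute[of _ "w t u"] wC)
  finally have tr: "trace (C t ** B ** C t ** H t u) = \<rho> t u * (e \<bullet> (B *v e) - trace ?CB)" .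
  have "\<Phi> (m t) = \<Phi> u + e \<bullet> g u + 1/2 * (e \<bullet> (B *v e))"
  proof -
    have "u + - e = m t" by (simp add: e_def)
    then show ?thesis
      using loss_expand[of u "- e"] by (simp add: linear_neg[OF matrix_vector_mul_linear])
  qed
  then have "\<rho>' t u = \<rho> t u * (e \<bullet> g u + 1/2 * (e \<bullet> (B *v e)) + 1/2 * trace ?CB)"
  proof -
    have "Z' t / Z t = - (\<Phi> (m t) + 1/2 * trace ?CB)"
      using \<rho>_gaussian(1)[OF t] by (simp add: Z'_eq t)
    with \<open>\<Phi> (m t) = _\<close>
    have "- \<Phi> u - Z' t / Z t = e \<bullet> g u + 1/2 * (e \<bullet> (B *v e)) + 1/2 * trace ?CB" by simp
    then show ?thesis by (simp only: \<rho>'_def)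
  qed
  then show ?thesis
    by (simp add: fokker_planck_rhs_def hessian_\<rho> M div tr algebra_simps)
qed

lemma regularity: "classical_regularity \<rho>"
proof -
  let ?S = "{0..} \<times> (UNIV :: (real^'l) set)"
  have fst: "continuous_on ?S (\<lambda>x. f (fst x))" if "continuous_on {0..} f" for f :: "real \<Rightarrow> real"
    by (rule continuous_on_compose2[OF that]) (auto intro: continuous_intros)
  have Z: "continuous_on ?S (\<lambda>x. Z (fst x))" "continuous_on ?S (\<lambda>x. Z' (fst x))"
    by (intro fst Z_continuous Z'_continuous)+
  have Z0: "Z (fst x) \<noteq> 0" if "x \<in> ?S" for x using that \<rho>_gaussian(1)[of "fst x"] by auto
  have c\<mu>0: "continuous_on ?S (\<lambda>x. \<mu>0 (snd x))"
    unfolding gaussian_density_def divide_inverse by (intro continuous_intros)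
  have c\<rho>: "continuous_on ?S (\<lambda>x. \<rho> (fst x) (snd x))"
    unfolding \<rho>_def tempered_density_def Z_def[symmetric]
    by (intro continuous_intros Z c\<mu>0 ballI Z0)
  have c\<rho>': "continuous_on ?S (\<lambda>x. \<rho>' (fst x) (snd x))"
    unfolding \<rho>'_def by (intro continuous_intros Z c\<rho> ballI Z0)
  have cw: "continuous_on ?S (\<lambda>x. w (fst x) (snd x))"
    unfolding w_def g_def by (intro continuous_intros)
  have cD: "continuous_on ?S (\<lambda>x. D (fst x) (snd x))"
    unfolding D_def by (intro continuous_intros c\<rho> cw)
  have cH: "continuous_on ?S (\<lambda>x. H (fst x) (snd x))"
    unfolding H_def outer_def P_def by (intro continuous_intros c\<rho> cw)
  show ?thesis
    unfolding classical_regularity_def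
    by (intro exI[of _ \<rho>'] exI[of _ D] exI[of _ H] conjI allI impI \<rho>_time_derivative \<rho>_GDERIV
        D_has_derivative) (simp_all add: case_prod_unfold c\<rho> c\<rho>' cD cH)
qed

lemma strong_solution_\<rho>: "strong_solution (\<lambda>u. A *v u) \<Gamma> y \<mu>0 \<rho>"
  unfolding strong_solution_def
proof (intro conjI allI impI regularity \<rho>_0)
  fix t :: real and u assume t: "t \<ge> 0"
  show "prob_density (\<rho> t)" "has_covariance (\<rho> t) (\<lambda>u. A *v u)"
    unfolding \<rho>_gaussian(2)[OF t] by (rule gaussian_density_covariance[OF C_spd[OF t]])+
  show "flux (\<lambda>u. A *v u) \<Gamma> y (\<rho> t) differentiable (at u)"
    using flux_has_derivative[OF t] by (rule differentiableI)
  show "((\<lambda>s. \<rho> s u) has_real_derivative fokker_planck_rhs (\<lambda>u. A *v u) \<Gamma> y (\<rho> t) u) (at t within {0..})"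
    unfolding fokker_planck_\<rho>[OF t] by (rule \<rho>_time_derivative[OF t])
qed

end

theorem mainTheorem4:
  fixes A :: "real^'l^'k" and \<Gamma> :: "real^'k^'k" and y :: "real^'k"
    and \<mu>0 :: "real^'l \<Rightarrow> real"
    and G :: "real^'l \<Rightarrow> real^'k" and \<mu> :: "real \<Rightarrow> real^'l \<Rightarrow> real"
  assumes "sym_pos_def \<Gamma>"
    and "is_gaussian_density \<mu>0"
    and "G = (\<lambda>u. A *v u)"
    and "\<mu> = tempered_density (loss \<Gamma> G y) \<mu>0"
  shows "strong_solution G \<Gamma> y \<mu>0 \<mu> \<and>
         (\<forall>u. \<mu> 1 u = posterior_density (loss \<Gamma> G y) \<mu>0 u)"
proof -
  obtain m0 C0 where C0: "sym_pos_def C0" and \<mu>0: "\<mu>0 = gaussian_density m0 C0"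
    using assms(2) unfolding is_gaussian_density_def by blast
  interpret linear_gaussian A \<Gamma> y m0 C0
    using assms(1) C0 by unfold_locales
  have "strong_solution G \<Gamma> y \<mu>0 \<mu>"
    using strong_solution_\<rho> unfolding \<rho>_def assms(3,4) \<mu>0 .
  then show ?thesis
    by (simp add: assms(4) tempered_density_def tempered_const_def posterior_density_def)
qed

end
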